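(* Let $a,b,c$ be positive integers with $b\le a\le c$. Then the number of lozenge tilings of the region $H_{\mathrm d}(a,b,c)$ is $$L(H_{\mathrm d}(a,b,c))=(-1)^{b(b+1)/2}\,P_b(a-2b-1,\,b+c+1),$$ where $$P_n(x,y)=\prod_{j=1}^{n}\frac{(j-1)!\,(x+y+2j)!\,(x-y+2j+1)_j\,(x+2y+3j+1)_{n-j}}{(x+n+2j)!\,(y+n-j)!}.$$
   Context: Shifted factorial: $(\alpha)_k=\alpha(\alpha+1)\cdots(\alpha+k-1)$ for $k\ge1$, and $(\alpha)_0=1$. Triangular lattice: let $e=(1,0)$, $f=(1/2,\sqrt3/2)$, $g=f-e=(-1/2,\sqrt3/2)$, and consider the lattice $\mathbb Z e+\mathbb Z f$ with its tiling of the plane by unit equilateral triangles. A lozenge is the union of two unit triangles sharing an edge. A lozenge tiling of a region $R$ (a finite union of unit triangles) is a decomposition of $R$ into lozenges with disjoint interiors; $L(R)$ is the number of lozenge tilings of $R$. $H(a,b,c)$ ($a,b,c$ positive integers) is the hexagon with vertices, in counterclockwise order, $0$ (southwestern corner), $be$ (southeastern corner), $be+af$ (eastern corner), $be+af+cg$ (northeastern corner), $af+cg$ (northwestern corner), $cg$ (western corner). Thus its horizontal sides have length $b$, the southeastern and northwestern sides have length $a$, and the northeastern and southwestern sides have length $c$. Maximal staircase at a corner $V$: let $p,q$ be the lengths of the two sides meeting at $V$, let $s,t$ be the unit vectors pointing from $V$ along these two sides (they form an angle of $120^\circ$), and let $m=\min(p,q)$. For $i,j\ge1$ let the cell $(i,j)$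 be the lozenge with vertices $V+(i-1)s+(j-1)t$, $V+is+(j-1)t$, $V+is+jt$, $V+(i-1)s+jt$. The maximal staircase at $V$ is the union of all cells $(i,j)$ with $i,j\ge1$ and $i+j\le m$ (so it has rows of $m-1,m-2,\dots,1$ lozenges). $H_{\mathrm d}(a,b,c)$ is the region obtained from $H(a,b,c)$ by removing the maximal staircases at the northwestern corner (where sides of lengths $a$ and $b$ meet) and at the eastern corner (where sides of lengths $a$ and $c$ meet). *)

theory Defs
  imports "HOL-Analysis.Analysis"
begin

section \<open>The triangular lattice and lozenge tilings\<close>

definition vec_e :: "real \<times> real" where
  "vec_e = (1, 0)"

definition vec_f :: "real \<times> real" where
  "vec_f = (1 / 2, sqrt 3 / 2)"

definition vec_g :: "real \<times> real" where
  "vec_g = vec_f - vec_e"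

definition lattice :: "(real \<times> real) set" where
  "lattice = {of_int i *\<^sub>R vec_e + of_int j *\<^sub>R vec_f | i j :: int. True}"

text \<open>Triangles and lozenges are closed regions of the plane.\<close>

definition unit_triangles :: "(real \<times> real) set set" where
  "unit_triangles =
     {convex hull {p, p + vec_e, p + vec_f} | p. p \<in> lattice} \<union>
     {convex hull {p, p + vec_f, p + vec_g} | p. p \<in> lattice}"

definition share_edge :: "(real \<times> real) set \<Rightarrow> (real \<times> real) set \<Rightarrow> bool" where
  "share_edge S T \<longleftrightarrow>
     (\<exists>u \<in> lattice. \<exists>v \<in> lattice. dist u v = 1 \<and> S \<inter> T = closed_segment u v)"

definition lozenges :: "(real \<times> real) set set" where
  "lozenges = {S \<union> T | S T. S \<in> unit_triangles \<and> T \<in> unit_triangles \<and> share_edge S T}"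

definition lozenge_tilings :: "(real \<times> real) set \<Rightarrow> (real \<times> real) set set set" where
  "lozenge_tilings R =
     {X. X \<subseteq> lozenges \<and>
         pairwise (\<lambda>A B. interior A \<inter> interior B = {}) X \<and>
         \<Union> X = R}"

definition num_lozenge_tilings :: "(real \<times> real) set \<Rightarrow> nat" where
  "num_lozenge_tilings R = card (lozenge_tilings R)"


section \<open>The hexagon and its maximal staircases\<close>

definition hexagon :: "nat \<Rightarrow> nat \<Rightarrow> nat \<Rightarrow> (real \<times> real) set" where
  "hexagon a b c = convex hull
     {0,
      real b *\<^sub>R vec_e,
      real b *\<^sub>R vec_e + real a *\<^sub>R vec_f,
      real b *\<^sub>R vec_e + real a *\<^sub>R vec_f + real c *\<^sub>R vec_g,
      real a *\<^sub>R vec_f + real c *\<^sub>R vec_g,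
      real c *\<^sub>R vec_g}"

definition staircase_cell ::
    "real \<times> real \<Rightarrow> real \<times> real \<Rightarrow> real \<times> real \<Rightarrow> nat \<Rightarrow> nat \<Rightarrow> (real \<times> real) set" where
  "staircase_cell V s t i j = convex hull
     {V + (real i - 1) *\<^sub>R s + (real j - 1) *\<^sub>R t,
      V + real i *\<^sub>R s + (real j - 1) *\<^sub>R t,
      V + real i *\<^sub>R s + real j *\<^sub>R t,
      V + (real i - 1) *\<^sub>R s + real j *\<^sub>R t}"

text \<open>The sides at the corner \<open>V\<close> have lengths \<open>p\<close> and \<open>q\<close>, and the unit vectors pointing from
  \<open>V\<close> along them are \<open>s\<close> and \<open>t\<close>, respectively.\<close>

definition maximal_staircase ::
    "real \<times> real \<Rightarrow> nat \<Rightarrow> real \<times> real \<Rightarrow> nat \<Rightarrow> real \<times> real \<Rightarrow> (real \<times> real) set" where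
  "maximal_staircase V p s q t =
     \<Union> {staircase_cell V s t i j | i j. 1 \<le> i \<and> 1 \<le> j \<and> i + j \<le> min p q}"

text \<open>The closure puts back the boundary between the removed staircases and the rest of the
  hexagon, so that the region is again a union of closed unit triangles.\<close>

definition hexagon_d :: "nat \<Rightarrow> nat \<Rightarrow> nat \<Rightarrow> (real \<times> real) set" where
  "hexagon_d a b c = closure
     (hexagon a b c
      - maximal_staircase (real a *\<^sub>R vec_f + real c *\<^sub>R vec_g) b vec_e a (- vec_f)
      - maximal_staircase (real b *\<^sub>R vec_e + real a *\<^sub>R vec_f) a (- vec_f) c vec_g)"


section \<open>The product formula\<close>

text \<open>The arguments \<open>x\<close> and \<open>y\<close> are integers, possibly negative; \<open>nat\<close> truncates, so the
  factorials are meaningful only where their arguments are nonnegative. This is the case for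
  \<open>x = a - 2 * b - 1\<close>, \<open>y = b + c + 1\<close>, \<open>n = b\<close> and \<open>1 \<le> b \<le> a\<close>, \<open>c \<ge> 0\<close>, where the arguments
  are \<open>a + c - b + 2 * j\<close>, \<open>a - b - 1 + 2 * j\<close> and \<open>2 * b + c + 1 - j\<close> with \<open>1 \<le> j \<le> b\<close>. The
  shifted factorials may have negative entries and are not affected.\<close>

definition P :: "nat \<Rightarrow> int \<Rightarrow> int \<Rightarrow> real" where
  "P n x y = (\<Prod>j = 1..n.
     (fact (j - 1) * fact (nat (x + y + 2 * int j))
        * pochhammer (of_int (x - y + 2 * int j + 1)) j
        * pochhammer (of_int (x + 2 * y + 3 * int j + 1)) (n - j))
     / (fact (nat (x + int n + 2 * int j)) * fact (nat (y + int n - int j))))"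

end

theory Submission
  imports Defs "Jordan_Normal_Form.Char_Poly"
begin

text \<open>A lozenge tiling of a union of unit triangles is a perfect matching of the triangles
along shared edges.  The triangles of the region are indexed here by their horizontal edges: an
upward triangle by its bottom edge, a downward triangle by its top edge.  An upright lozenge then
matches a horizontal edge with itself, and the other two kinds of lozenge move from a horizontal
edge to one in the next row, half a unit to the left or to the right.  So a tiling is a family of
nonintersecting lattice paths.  They start at the bottom side of the hexagon.  The staircase at
the northwestern corner leaves exactly one free horizontal edge under (or on) each edge of the top
side, and these are the end points.  The staircase at the eastern corner has a zigzag boundary,
which acts as a vertical wall that the paths must not touch; the reflection principle turns the
number of paths between two points to its left into a difference of two binomial coefficients.

The number of families is a determinant (\<open>card_matchings_eq_det\<close>).  Its proof does not pass
through path families: both sides satisfy the same recurrence when a topmost edge is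
removed, the determinant by linearity in one row.  This argument uses only the recurrence
of the matrix entries, their vanishing outside the region, and a unit determinant in the bottom
row.  Any combination of starting points with a unitriangular matrix is therefore as good as the
path counts themselves.  The one chosen here (\<open>wall_paths\<close>) adds two steps for each further
starting point.  Its entries at the end points are, up to a factor that depends only on the row,
quotients \<open>(A + B - 1)! / (A! B!)\<close> with \<open>A = X - 2 * i + m\<close> and \<open>B = Y + i + m\<close> linear in the row
index \<open>i\<close> and the column index \<open>m\<close>.

Shifting the row or the column index in this matrix only changes the parameters \<open>X\<close> and \<open>Y\<close>.
So the Desnanot-Jacobi identity is a recurrence within the family of these determinants
(\<open>det_reduced_entry\<close>).  The claimed product satisfies the same recurrence: each kind of factor
contributes at most one linear polynomial to the numerator or denominator of either term, and what
remains is the polynomial identity \<open>condense_coeff\<close>.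

The link between regions in the plane and sets of triangles is made by generic points, those for
which the three lattice coordinates are not integers.  They are dense and lie in exactly one unit
triangle, so that closures, interiors and differences of unions of triangles can be read off from
the index sets (\<open>num_lozenge_tilings_region\<close>, \<open>hexagon_d_eq\<close>).\<close>

section \<open>Determinants of functions and the Desnanot-Jacobi identity\<close>

text \<open>The matrix is given by a function on indices, so that deleting rows and columns is a
substitution in the arguments.\<close>

definition detf :: "nat \<Rightarrow> (nat \<Rightarrow> nat \<Rightarrow> 'a) \<Rightarrow> 'a :: comm_ring_1" where
  "detf n f = Determinant.det (mat n n (\<lambda>(i, j). f i j))"

lemma detf_cong:
  "(\<And>i j. i < n \<Longrightarrow> j < n \<Longrightarrow> f i j = g i j) \<Longrightarrow> detf n f = detf n g"
  unfolding detf_def by (intro arg_cong[of _ _ Determinant.det] cong_mat) auto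

lemma detf_0 [simp]: "detf 0 f = 1"
  by (simp add: detf_def)

lemma detf_triangular:
  fixes f :: "nat \<Rightarrow> nat \<Rightarrow> 'a :: comm_ring_1"
  assumes "\<And>i j. i < j \<Longrightarrow> j < n \<Longrightarrow> f i j = 0"
  shows "detf n f = (\<Prod>i<n. f i i)"
  unfolding detf_def
  by (subst det_lower_triangular[of n]) (auto simp: assms prod_list_diag_prod lessThan_atLeast0)

lemma detf_triangular':
  fixes f :: "nat \<Rightarrow> nat \<Rightarrow> 'a :: comm_ring_1"
  assumes "\<And>i j. j < i \<Longrightarrow> i < n \<Longrightarrow> f i j = 0"
  shows "detf n f = (\<Prod>i<n. f i i)"
  unfolding detf_def
  by (subst det_upper_triangular[of _ n]) (auto simp: assms prod_list_diag_prod lessThan_atLeast0)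

lemma mat_delete_fun:
  "mat_delete (mat (Suc n) (Suc n) (\<lambda>(i, j). f i j)) k l =
     mat n n (\<lambda>(i, j). f (insert_index k i) (insert_index l j))"
  by (rule eq_matI) (auto simp: mat_delete_def insert_index_def)

lemma detf_expand_row:
  fixes f :: "nat \<Rightarrow> nat \<Rightarrow> 'a :: comm_ring_1"
  assumes "k < Suc n"
  shows "detf (Suc n) f =
    (\<Sum>l<Suc n. f k l * ((-1) ^ (k + l) * detf n (\<lambda>i j. f (insert_index k i) (insert_index l j))))"
  unfolding detf_def
  by (subst laplace_expansion_row[OF _ assms]) (auto simp: cofactor_def mat_delete_fun assms)

lemma detf_expand_column:
  fixes f :: "nat \<Rightarrow> nat \<Rightarrow> 'a :: comm_ring_1"
  assumes "l < Suc n"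
  shows "detf (Suc n) f =
    (\<Sum>k<Suc n. f k l * ((-1) ^ (k + l) * detf n (\<lambda>i j. f (insert_index k i) (insert_index l j))))"
  unfolding detf_def
  by (subst laplace_expansion_column[OF _ assms]) (auto simp: cofactor_def mat_delete_fun assms)

lemma detf_expand_row_single:
  fixes f :: "nat \<Rightarrow> nat \<Rightarrow> 'a :: comm_ring_1"
  assumes "k < Suc n" "l < Suc n" "\<And>j. j < Suc n \<Longrightarrow> j \<noteq> l \<Longrightarrow> f k j = 0"
  shows "detf (Suc n) f =
    f k l * ((-1) ^ (k + l) * detf n (\<lambda>i j. f (insert_index k i) (insert_index l j)))"
  unfolding detf_expand_row[OF assms(1)]
  using assms by (subst sum.remove[of _ l]) (auto intro!: sum.neutral)

lemma detf_expand_column_single: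
  fixes f :: "nat \<Rightarrow> nat \<Rightarrow> 'a :: comm_ring_1"
  assumes "k < Suc n" "l < Suc n" "\<And>i. i < Suc n \<Longrightarrow> i \<noteq> k \<Longrightarrow> f i l = 0"
  shows "detf (Suc n) f =
    f k l * ((-1) ^ (k + l) * detf n (\<lambda>i j. f (insert_index k i) (insert_index l j)))"
  unfolding detf_expand_column[OF assms(2)]
  using assms by (subst sum.remove[of _ k]) (auto intro!: sum.neutral)

lemma detf_mult:
  fixes f g :: "nat \<Rightarrow> nat \<Rightarrow> 'a :: comm_ring_1"
  shows "detf n (\<lambda>i j. \<Sum>k<n. f i k * g k j) = detf n f * detf n g"
proof -
  have "mat n n (\<lambda>(i, j). \<Sum>k<n. f i k * g k j)
      = mat n n (\<lambda>(i, j). f i j) * mat n n (\<lambda>(i, j). g i j)"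
    by (rule eq_matI) (auto simp: scalar_prod_def lessThan_atLeast0)
  then show ?thesis
    unfolding detf_def by (simp add: Determinant.det_mult[of _ n])
qed

text \<open>The product of the matrix with a column of its adjugate.\<close>

lemma adjugate_column:
  fixes f :: "nat \<Rightarrow> nat \<Rightarrow> 'a :: comm_ring_1"
  assumes "i < Suc n" "l < Suc n"
  shows "(\<Sum>k<Suc n. f i k * ((-1) ^ (l + k) *
            detf n (\<lambda>i j. f (insert_index l i) (insert_index k j)))) =
         (if i = l then detf (Suc n) f else 0)"
proof -
  let ?A = "mat (Suc n) (Suc n) (\<lambda>(i, j). f i j)"
  have A: "?A \<in> carrier_mat (Suc n) (Suc n)" by simp
  have "(?A * adj_mat ?A) $$ (i, l) = (Determinant.det ?A \<cdot>\<^sub>m 1\<^sub>m (Suc n)) $$ (i, l)"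
    by (simp add: adj_mat(2)[OF A])
  then show ?thesis
    using assms unfolding detf_def
    by (simp add: adj_mat_def scalar_prod_def cofactor_def mat_delete_fun lessThan_atLeast0
             del: sum.op_ivl_Suc split: if_splits)
qed

lemma detf_add_row:
  fixes f :: "nat \<Rightarrow> nat \<Rightarrow> 'a :: comm_ring_1"
  assumes "k < n" "\<And>i j. i \<noteq> k \<Longrightarrow> g i j = f i j" "\<And>i j. i \<noteq> k \<Longrightarrow> h i j = f i j"
    "\<And>j. j < n \<Longrightarrow> f k j = g k j + h k j"
  shows "detf n f = detf n g + detf n h"
proof -
  obtain m where n: "n = Suc m" using assms(1) by (cases n) auto
  have "detf m (\<lambda>i j. g (insert_index k i) (insert_index l j)) = detf m (\<lambda>i j. f (insert_index k i) (insert_index l j))"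
    "detf m (\<lambda>i j. h (insert_index k i) (insert_index l j)) = detf m (\<lambda>i j. f (insert_index k i) (insert_index l j))" for l
    by (auto intro!: detf_cong simp: insert_index_def assms)
  then show ?thesis
    using assms unfolding n
    by (simp add: detf_expand_row[OF assms(1)[unfolded n]] sum.distrib[symmetric] algebra_simps del: sum.lessThan_Suc)
qed

lemma detf_zero_row:
  fixes f :: "nat \<Rightarrow> nat \<Rightarrow> 'a :: comm_ring_1"
  assumes "k < n" "\<And>j. j < n \<Longrightarrow> f k j = 0"
  shows "detf n f = 0"
proof -
  obtain m where m: "n = Suc m" using assms(1) by (cases n) auto
  show ?thesis using assms unfolding m by (subst detf_expand_row[of k]) auto
qed

lemma detf_equal_rows:
  fixes f :: "nat \<Rightarrow> nat \<Rightarrow> 'a :: comm_ring_1"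
  assumes "k < n" "l < n" "k \<noteq> l" "\<And>j. j < n \<Longrightarrow> f k j = f l j"
  shows "detf n f = 0"
  unfolding detf_def using assms
  by (intro det_identical_rows[of _ n k l]) (auto simp: Matrix.row_def)

lemma detf_scale_rows:
  fixes f :: "nat \<Rightarrow> nat \<Rightarrow> 'a :: comm_ring_1"
  shows "detf n (\<lambda>i j. r i * f i j) = (\<Prod>i<n. r i) * detf n f"
proof -
  have "detf n (\<lambda>i j. r i * f i j) = detf n (\<lambda>i j. \<Sum>k<n. (if i = k then r i else 0) * f k j)"
    by (rule detf_cong) (simp add: if_distrib[of "\<lambda>x. x * _"] cong: if_cong)
  also have "\<dots> = detf n (\<lambda>i k. if i = k then r i else 0) * detf n f"
    by (rule detf_mult)
  also have "detf n (\<lambda>i k. if i = k then r i else 0) = (\<Prod>i<n. r i)"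
    by (subst detf_triangular) auto
  finally show ?thesis .
qed

text \<open>Let \<open>p\<close> be the identity matrix with its first and last column replaced by those of the
adjugate.  Multiplying the given matrix by \<open>p\<close> replaces its first and last column by multiples of
unit vectors, so the determinant of the product is the square of the full determinant times the
interior minor.  The determinant of \<open>p\<close> itself is a two by two minor of the adjugate.  One factor,
the full determinant, is cancelled.\<close>

lemma Desnanot_Jacobi_nonsingular:
  fixes f :: "nat \<Rightarrow> nat \<Rightarrow> 'a :: idom"
  assumes nz: "detf (n + 2) f \<noteq> 0"
  shows "detf (n + 2) f * detf n (\<lambda>i j. f (Suc i) (Suc j)) =
         detf (n + 1) f * detf (n + 1) (\<lambda>i j. f (Suc i) (Suc j))
       - detf (n + 1) (\<lambda>i j. f (Suc i) j) * detf (n + 1) (\<lambda>i j. f i (Suc j))"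
proof -
  define D where "D = detf (n + 2) f"
  define a where "a k l = (-1) ^ (l + k) *
      detf (n + 1) (\<lambda>i j. f (insert_index l i) (insert_index k j))" for k l
  define p where "p i j = (if j = 0 \<or> j = n + 1 then a i j else if i = j then 1 else 0)" for i j
  define q where "q i j = (if j = 0 \<or> j = n + 1 then if i = j then D else 0 else f i j)" for i j
  have prod: "(\<Sum>k<n + 2. f i k * p k j) = q i j" if "i < n + 2" "j < n + 2" for i j
  proof (cases "j = 0 \<or> j = n + 1")
    case True
    then show ?thesis
      using adjugate_column[of i "n + 1" j f] that by (auto simp: p_def q_def a_def D_def)
  next
    case False
    then have "(\<Sum>k<n + 2. f i k * p k j) = (\<Sum>k<n + 2. if k = j then f i k else 0)"
      by (intro sum.cong) (auto simp: p_def)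
    then show ?thesis using False that by (simp add: q_def)
  qed
  have "D * detf (n + 2) p = detf (n + 2) q"
    unfolding D_def detf_mult[symmetric] by (rule detf_cong) (rule prod)
  also have "detf (n + 2) q = D * detf (n + 1) (\<lambda>i j. q (Suc i) (Suc j))"
    using detf_expand_column_single[of 0 "n + 1" 0 q] by (simp add: q_def insert_index_def)
  also have "detf (n + 1) (\<lambda>i j. q (Suc i) (Suc j)) = D * detf n (\<lambda>i j. f (Suc i) (Suc j))"
  proof -
    have "detf n (\<lambda>i j. q (Suc (insert_index n i)) (Suc (insert_index n j))) =
        detf n (\<lambda>i j. f (Suc i) (Suc j))"
      by (rule detf_cong) (auto simp: q_def insert_index_def)
    then show ?thesis
      using detf_expand_column_single[of n n n "\<lambda>i j. q (Suc i) (Suc j)"]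
      by (simp add: q_def)
  qed
  finally have 1: "detf (n + 2) p = D * detf n (\<lambda>i j. f (Suc i) (Suc j))"
    using nz by (simp add: D_def)
  have "detf (n + 2) p =
      a (n + 1) 0 * ((-1) ^ (n + 1) * detf (n + 1) (\<lambda>i j. p i (Suc j)))
      + a (n + 1) (n + 1) * detf (n + 1) p"
  proof -
    define t where "t l = p (n + 1) l * ((-1) ^ (n + 1 + l) *
        detf (n + 1) (\<lambda>i j. p (insert_index (n + 1) i) (insert_index l j)))" for l
    have "detf (n + 2) p = (\<Sum>l<Suc (n + 1). t l)"
      using detf_expand_row[of "n + 1" "n + 1" p] by (simp add: t_def)
    also have "\<dots> = (\<Sum>l\<in>{0, n + 1}. t l)"
      by (rule sum.mono_neutral_right) (auto simp: t_def p_def)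
    also have "\<dots> = t 0 + t (n + 1)" by simp
    also have "t 0 = a (n + 1) 0 * ((-1) ^ (n + 1) * detf (n + 1) (\<lambda>i j. p i (Suc j)))"
    proof -
      have "detf (n + 1) (\<lambda>i j. p (insert_index (n + 1) i) (insert_index 0 j)) =
          detf (n + 1) (\<lambda>i j. p i (Suc j))"
        by (rule detf_cong) (auto simp: insert_index_def)
      then show ?thesis by (simp add: t_def p_def)
    qed
    also have "t (n + 1) = a (n + 1) (n + 1) * detf (n + 1) p"
    proof -
      have "detf (n + 1) (\<lambda>i j. p (insert_index (n + 1) i) (insert_index (n + 1) j)) =
          detf (n + 1) p"
        by (rule detf_cong) (auto simp: insert_index_def)
      then show ?thesis by (simp add: t_def p_def)
    qed
    finally show ?thesis .
  qed
  also have "detf (n + 1) p = a 0 0"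
  proof -
    have "detf (n + 1) p = (\<Prod>i<n + 1. p i i)" by (rule detf_triangular) (auto simp: p_def)
    also have "\<dots> = (\<Prod>i<n + 1. if i = 0 then a 0 0 else 1)" by (rule prod.cong) (auto simp: p_def)
    finally show ?thesis by simp
  qed
  also have "detf (n + 1) (\<lambda>i j. p i (Suc j)) = (-1) ^ n * a 0 (n + 1)"
  proof -
    have "detf n (\<lambda>i j. p (Suc i) (Suc (insert_index n j))) = detf n (\<lambda>i j. if i = j then 1 else 0)"
      by (rule detf_cong) (auto simp: p_def insert_index_def)
    also have "\<dots> = 1" by (subst detf_triangular) auto
    finally show ?thesis
      using detf_expand_row_single[of 0 n n "\<lambda>i j. p i (Suc j)"]
      by (simp add: p_def insert_index_def)
  qed
  finally have "detf (n + 2) p = a (n + 1) (n + 1) * a 0 0 - a (n + 1) 0 * a 0 (n + 1)"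
    by (simp add: algebra_simps)
  moreover have "a 0 0 = detf (n + 1) (\<lambda>i j. f (Suc i) (Suc j))"
    by (simp add: a_def insert_index_def)
  moreover have "a (n + 1) (n + 1) = detf (n + 1) f"
    by (auto simp: a_def insert_index_def intro!: detf_cong)
  moreover have "a (n + 1) 0 = (-1) ^ (n + 1) * detf (n + 1) (\<lambda>i j. f (Suc i) j)"
    by (auto simp: a_def insert_index_def intro!: detf_cong)
  moreover have "a 0 (n + 1) = (-1) ^ (n + 1) * detf (n + 1) (\<lambda>i j. f i (Suc j))"
    by (auto simp: a_def insert_index_def intro!: detf_cong)
  ultimately show ?thesis using 1 by (simp add: D_def algebra_simps)
qed

text \<open>For a singular matrix, an indeterminate is added to the diagonal.  The determinant becomes
the characteristic polynomial of the negated matrix, which is not zero, and the identity over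
polynomials is evaluated at zero.\<close>

theorem Desnanot_Jacobi:
  fixes f :: "nat \<Rightarrow> nat \<Rightarrow> 'a :: idom"
  shows "detf (n + 2) f * detf n (\<lambda>i j. f (Suc i) (Suc j)) =
         detf (n + 1) f * detf (n + 1) (\<lambda>i j. f (Suc i) (Suc j))
       - detf (n + 1) (\<lambda>i j. f (Suc i) j) * detf (n + 1) (\<lambda>i j. f i (Suc j))"
proof -
  define g where "g i j = [:f i j, if i = j then 1 else 0:]" for i j
  have hom: "comm_ring_hom (\<lambda>p :: 'a poly. poly p 0)"
    by standard auto
  have ev: "poly (detf m h) 0 = detf m (\<lambda>i j. poly (h i j) 0)"
    for m and h :: "nat \<Rightarrow> nat \<Rightarrow> 'a poly"
  proof -
    have "map_mat (\<lambda>p. poly p 0) (mat m m (\<lambda>(i, j). h i j)) = mat m m (\<lambda>(i, j). poly (h i j) 0)"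
      by (rule eq_matI) auto
    then show ?thesis by (simp add: detf_def flip: comm_ring_hom.hom_det[OF hom])
  qed
  define A where "A = mat (n + 2) (n + 2) (\<lambda>(i, j). - f i j)"
  have "char_poly_matrix A = mat (n + 2) (n + 2) (\<lambda>(i, j). g i j)"
    by (rule eq_matI) (auto simp: char_poly_matrix_def A_def g_def)
  then have "detf (n + 2) g = char_poly A"
    by (simp add: detf_def char_poly_def)
  moreover have "char_poly A \<noteq> 0"
    using degree_monic_char_poly[of A "n + 2"] by (auto simp: A_def)
  ultimately have "detf (n + 2) g \<noteq> 0" by simp
  from arg_cong[OF Desnanot_Jacobi_nonsingular[OF this], of "\<lambda>p. poly p 0"]
  show ?thesis by (simp add: ev g_def cong: if_cong)
qed

section \<open>Evaluation of the reduced determinant by condensation\<close>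

text \<open>The reciprocal factorial, with its natural value zero at negative integers.\<close>

definition rfact :: "int \<Rightarrow> real" where
  "rfact k = (if k < 0 then 0 else 1 / fact (nat k))"

definition ifact :: "int \<Rightarrow> real" where
  "ifact k = fact (nat k)"

lemma ifact_pos: "ifact k > 0"
  by (simp add: ifact_def)

lemma rfact_pos: "0 \<le> k \<Longrightarrow> rfact k > 0"
  by (simp add: rfact_def)

lemma ifact_rec: "1 \<le> k \<Longrightarrow> ifact k = of_int k * ifact (k - 1)"
  by (cases "nat k") (auto simp: ifact_def nat_diff_distrib nat_eq_iff2)

lemma rfact_rec: "rfact (k - 1) = of_int k * rfact k"
proof (cases "1 \<le> k")
  case True
  then obtain m where "nat k = Suc m" by (cases "nat k") auto
  then have k: "k = int m + 1" by linarith
  have "(1 + real m) * fact m \<noteq> 0" by simp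
  then show ?thesis by (simp add: k rfact_def nat_add_distrib divide_simps)
qed (auto simp: rfact_def)

definition prod2 :: "(int \<Rightarrow> real) \<Rightarrow> nat \<Rightarrow> int \<Rightarrow> real" where
  "prod2 f n t = (\<Prod>i<n. f (t + 2 * int i))"

text \<open>The products over arithmetic progressions telescope when their length and starting point
change together.  All ratios needed for the condensation step come from splitting off the first
or the last factor.\<close>

lemma prod2_first: "prod2 f (Suc n) t = f t * prod2 f n (t + 2)"
  by (simp add: prod2_def prod.lessThan_Suc_shift algebra_simps del: prod.lessThan_Suc)

lemma prod2_last: "prod2 f (Suc n) t = prod2 f n t * f (t + 2 * int n)"
  by (simp add: prod2_def)

lemma prod2_first': "t' = t + 2 \<Longrightarrow> prod2 f (n + 1) t = f t * prod2 f n t'"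
  by (simp add: prod2_first)

lemma prod2_last': "t' = t + 2 * int n \<Longrightarrow> prod2 f (n + 1) t = prod2 f n t * f t'"
  by (simp add: prod2_last)

definition prod1 :: "(int \<Rightarrow> real) \<Rightarrow> nat \<Rightarrow> int \<Rightarrow> real" where
  "prod1 f n t = (\<Prod>i<n. f (t + int i))"

lemma prod1_first: "prod1 f (Suc n) t = f t * prod1 f n (t + 1)"
  by (simp add: prod1_def prod.lessThan_Suc_shift algebra_simps del: prod.lessThan_Suc)

lemma prod1_last: "prod1 f (Suc n) t = prod1 f n t * f (t + int n)"
  by (simp add: prod1_def)

lemma prod1_first': "t' = t + 1 \<Longrightarrow> prod1 f (n + 1) t = f t * prod1 f n t'"
  by (simp add: prod1_first)

lemma prod1_last': "t' = t + int n \<Longrightarrow> prod1 f (n + 1) t = prod1 f n t * f t'"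
  by (simp add: prod1_last)

text \<open>The product of rising factorials that occurs twice in the evaluation, once for \<open>Y - X\<close> and
once for \<open>X + 2 * Y\<close>.\<close>

definition poch3 :: "nat \<Rightarrow> int \<Rightarrow> real" where
  "poch3 n d = (\<Prod>i<n. pochhammer (of_int (d + 1 + 3 * int i)) (n - 1 - i))"

lemma poch3_Suc: "poch3 (Suc n) d = poch3 n d * prod2 of_int n (d + int n)"
proof -
  have "poch3 (Suc n) d = (\<Prod>i<n. pochhammer (of_int (d + 1 + 3 * int i)) (n - i))"
    by (simp add: poch3_def)
  also have "\<dots> = (\<Prod>i<n. pochhammer (of_int (d + 1 + 3 * int i)) (n - 1 - i)
                      * of_int (d + int n + 2 * int i))"
  proof (rule prod.cong)
    fix i assume "i \<in> {..<n}"
    then have "n - i = Suc (n - 1 - i)" and [simp]: "real (n - Suc i) = real n - real i - 1"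
      by auto
    then show "(pochhammer (of_int (d + 1 + 3 * int i)) (n - i) :: real) =
        pochhammer (of_int (d + 1 + 3 * int i)) (n - 1 - i) * of_int (d + int n + 2 * int i)"
      by (simp only: pochhammer_Suc) (simp add: algebra_simps)
  qed auto
  also have "\<dots> = poch3 n d * prod2 of_int n (d + int n)"
    by (simp add: poch3_def prod2_def prod.distrib)
  finally show ?thesis .
qed

lemma poch3_pos: "0 \<le> d \<Longrightarrow> poch3 n d > 0"
  unfolding poch3_def by (intro prod_pos) (auto intro!: pochhammer_pos)

lemma poch3_condense:
  "poch3 (m + 1) d * poch3 (m + 1) (d + 3) * of_int (d + int m + 1)
     = poch3 (m + 2) d * poch3 m (d + 3)"
proof -
  have "poch3 (m + 2) d = poch3 (m + 1) d * (of_int (d + int m + 1) * prod2 of_int m (d + int m + 3))"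
    using poch3_Suc[of "m + 1" d] prod2_first[of of_int m "d + int m + 1"] by (simp add: algebra_simps)
  moreover have "poch3 (m + 1) (d + 3) = poch3 m (d + 3) * prod2 of_int m (d + int m + 3)"
    using poch3_Suc[of m "d + 3"] by (simp add: algebra_simps)
  ultimately show ?thesis by simp
qed

definition reduced_entry :: "int \<Rightarrow> int \<Rightarrow> nat \<Rightarrow> nat \<Rightarrow> real" where
  "reduced_entry X Y i m = ifact (X + Y - int i + 2 * int m - 1)
     * rfact (X - 2 * int i + int m) * rfact (Y + int i + int m)"

text \<open>The value of the determinant of \<open>reduced_entry\<close>.  For \<open>X = n - 2\<close> and
\<open>n > 0\<close> the first factor of \<open>prod2 rfact\<close> is zero, and so is the last row of the matrix.\<close>

definition reduced_product :: "nat \<Rightarrow> int \<Rightarrow> int \<Rightarrow> real" where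
  "reduced_product n X Y = (\<Prod>i<n. fact i) * prod2 ifact n (X + Y - int n)
     * poch3 n (Y - X) * poch3 n (X + 2 * Y)
     * prod2 rfact n (X + 1 - int n) * prod1 rfact n (Y + int n - 1)"

lemma reduced_product_eq:
  assumes "b = X + Y - int n" "d = Y - X" "w = X + 2 * Y" "e = X + 1 - int n" "f = Y + int n - 1"
  shows "reduced_product n X Y = (\<Prod>i<n. fact i) * prod2 ifact n b * poch3 n d * poch3 n w
     * prod2 rfact n e * prod1 rfact n f"
  by (simp add: reduced_product_def assms)

text \<open>The three products are what remains of the three terms of the recurrence after division by
their common factors.\<close>

lemma condense_coeff:
  fixes x y m :: real
  shows "(x + y - m) * (x + m) * (y + m) - (x + y + m) * (x - m) * (y + 2 * m)
    = m * (y - x + m) * (x + 2 * y + m)"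
  by (simp add: algebra_simps)

text \<open>The facts below are named after the kind of factor (\<open>b\<close> for the numerator factorials, \<open>e\<close>
and \<open>f\<close> for the reciprocal ones), with index 1 or 2 for the first or second product on the right of
the recurrence.  Each compares such a product with the one on the left; the quotient is linear in
\<open>X\<close>, \<open>Y\<close> and \<open>m\<close>.  The factors of the kinds \<open>a\<close>, \<open>c\<close> and \<open>d\<close> give the same quotient in both
products.\<close>

lemma reduced_product_condense:
  fixes X Y :: int and m :: nat
  assumes X: "int m + 1 \<le> X" and Y: "1 \<le> Y" and XY: "X < Y"
  shows "reduced_product (m + 2) X Y * reduced_product m (X - 1) (Y + 2) =
     reduced_product (m + 1) X Y * reduced_product (m + 1) (X - 1) (Y + 2)
   - reduced_product (m + 1) (X - 2) (Y + 1) * reduced_product (m + 1) (X + 1) (Y + 1)"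
proof -
  define x y M where "x = real_of_int X" and "y = real_of_int Y" and "M = real m + 1"
  let ?a = "\<lambda>n. \<Prod>i<n. fact i :: real"
  have a: "?a (m + 1) * ?a (m + 1) * M = ?a (m + 2) * ?a m"
    by (simp add: M_def algebra_simps)
  have b1: "prod2 ifact (m + 1) (X + Y - int m - 1) * prod2 ifact (m + 1) (X + Y - int m) =
      (x + y - M) * (prod2 ifact (m + 2) (X + Y - int m - 2) * prod2 ifact m (X + Y - int m + 1))"
  proof -
    have p: "prod2 ifact (m + 1) (X + Y - int m - 1) = ifact (X + Y - int m - 1) * prod2 ifact (m) (X + Y - int m + 1)"
      using prod2_first'[where t' = "X + Y - int m + 1" and t = "X + Y - int m - 1" and f = ifact and n = "m"]
      by (simp add: algebra_simps)
    have q: "prod2 ifact (m + 2) (X + Y - int m - 2) = ifact (X + Y - int m - 2) * prod2 ifact (m + 1) (X + Y - int m)"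
      using prod2_first'[where t' = "X + Y - int m" and t = "X + Y - int m - 2" and f = ifact and n = "m + 1"]
      by (simp add: algebra_simps)
    have r: "ifact (X + Y - int m - 1) = (x + y - M) * ifact (X + Y - int m - 2)"
      using ifact_rec[of "X + Y - int m - 1"] X Y by (simp add: x_def y_def M_def algebra_simps)
    show ?thesis unfolding q p r by (simp only: mult_ac)
  qed
  have b2: "prod2 ifact (m + 1) (X + Y - int m - 2) * prod2 ifact (m + 1) (X + Y - int m + 1) =
      (x + y + M) * (prod2 ifact (m + 2) (X + Y - int m - 2) * prod2 ifact m (X + Y - int m + 1))"
  proof -
    have p: "prod2 ifact (m + 1) (X + Y - int m + 1) = prod2 ifact (m) (X + Y - int m + 1) * ifact (X + Y + int m + 1)"
      using prod2_last'[where t' = "X + Y + int m + 1" and t = "X + Y - int m + 1" and f = ifact and n = "m"]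
      by (simp add: algebra_simps)
    have q: "prod2 ifact (m + 2) (X + Y - int m - 2) = prod2 ifact (m + 1) (X + Y - int m - 2) * ifact (X + Y + int m)"
      using prod2_last'[where t' = "X + Y + int m" and t = "X + Y - int m - 2" and f = ifact and n = "m + 1"]
      by (simp add: algebra_simps)
    have r: "ifact (X + Y + int m + 1) = (x + y + M) * ifact (X + Y + int m)"
      using ifact_rec[of "X + Y + int m + 1"] X Y by (simp add: x_def y_def M_def algebra_simps)
    show ?thesis unfolding q p r by (simp only: mult_ac)
  qed
  have c: "poch3 (m + 1) (Y - X) * poch3 (m + 1) (Y - X + 3) * (y - x + M)
      = poch3 (m + 2) (Y - X) * poch3 m (Y - X + 3)"
    using poch3_condense[of m "Y - X"] by (simp add: x_def y_def M_def algebra_simps)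
  have d: "poch3 (m + 1) (X + 2 * Y) * poch3 (m + 1) (X + 2 * Y + 3) * (x + 2 * y + M)
      = poch3 (m + 2) (X + 2 * Y) * poch3 m (X + 2 * Y + 3)"
    using poch3_condense[of m "X + 2 * Y"] by (simp add: x_def y_def M_def algebra_simps)
  have e1: "prod2 rfact (m + 1) (X - int m) * prod2 rfact (m + 1) (X - int m - 1) =
      (x + M) * (prod2 rfact (m + 2) (X - int m - 1) * prod2 rfact m (X - int m))"
  proof -
    have p: "prod2 rfact (m + 1) (X - int m) = prod2 rfact (m) (X - int m) * rfact (X + int m)"
      using prod2_last'[where t' = "X + int m" and t = "X - int m" and f = rfact and n = "m"]
      by (simp add: algebra_simps)
    have q: "prod2 rfact (m + 2) (X - int m - 1) = prod2 rfact (m + 1) (X - int m - 1) * rfact (X + int m + 1)"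
      using prod2_last'[where t' = "X + int m + 1" and t = "X - int m - 1" and f = rfact and n = "m + 1"]
      by (simp add: algebra_simps)
    have r: "rfact (X + int m) = (x + M) * rfact (X + int m + 1)"
      using rfact_rec[of "X + int m + 1"] X Y by (simp add: x_def y_def M_def algebra_simps)
    show ?thesis unfolding q p r by (simp only: mult_ac)
  qed
  have e2: "prod2 rfact (m + 1) (X - int m - 2) * prod2 rfact (m + 1) (X - int m + 1) =
      (x - M) * (prod2 rfact (m + 2) (X - int m - 1) * prod2 rfact m (X - int m))"
  proof -
    have p: "prod2 rfact (m + 1) (X - int m - 2) = rfact (X - int m - 2) * prod2 rfact (m) (X - int m)"
      using prod2_first'[where t' = "X - int m" and t = "X - int m - 2" and f = rfact and n = "m"]
      by (simp add: algebra_simps)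
    have q: "prod2 rfact (m + 2) (X - int m - 1) = rfact (X - int m - 1) * prod2 rfact (m + 1) (X - int m + 1)"
      using prod2_first'[where t' = "X - int m + 1" and t = "X - int m - 1" and f = rfact and n = "m + 1"]
      by (simp add: algebra_simps)
    have r: "rfact (X - int m - 2) = (x - M) * rfact (X - int m - 1)"
      using rfact_rec[of "X - int m - 1"] X Y by (simp add: x_def y_def M_def algebra_simps)
    show ?thesis unfolding q p r by (simp only: mult_ac)
  qed
  have f1: "prod1 rfact (m + 1) (Y + int m) * prod1 rfact (m + 1) (Y + int m + 2) =
      (y + M) * (prod1 rfact (m + 2) (Y + int m + 1) * prod1 rfact m (Y + int m + 1))"
  proof -
    have p: "prod1 rfact (m + 1) (Y + int m) = rfact (Y + int m) * prod1 rfact (m) (Y + int m + 1)"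
      using prod1_first'[where t' = "Y + int m + 1" and t = "Y + int m" and f = rfact and n = "m"]
      by (simp add: algebra_simps)
    have q: "prod1 rfact (m + 2) (Y + int m + 1) = rfact (Y + int m + 1) * prod1 rfact (m + 1) (Y + int m + 2)"
      using prod1_first'[where t' = "Y + int m + 2" and t = "Y + int m + 1" and f = rfact and n = "m + 1"]
      by (simp add: algebra_simps)
    have r: "rfact (Y + int m) = (y + M) * rfact (Y + int m + 1)"
      using rfact_rec[of "Y + int m + 1"] X Y by (simp add: x_def y_def M_def algebra_simps)
    show ?thesis unfolding q p r by (simp only: mult_ac)
  qed
  have f2: "prod1 rfact (m + 1) (Y + int m + 1) * prod1 rfact (m + 1) (Y + int m + 1) =
      (y + 2 * M) * (prod1 rfact (m + 2) (Y + int m + 1) * prod1 rfact m (Y + int m + 1))"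
  proof -
    have p: "prod1 rfact (m + 1) (Y + int m + 1) = prod1 rfact (m) (Y + int m + 1) * rfact (Y + 2 * int m + 1)"
      using prod1_last'[where t' = "Y + 2 * int m + 1" and t = "Y + int m + 1" and f = rfact and n = "m"]
      by (simp add: algebra_simps)
    have q: "prod1 rfact (m + 2) (Y + int m + 1) = prod1 rfact (m + 1) (Y + int m + 1) * rfact (Y + 2 * int m + 2)"
      using prod1_last'[where t' = "Y + 2 * int m + 2" and t = "Y + int m + 1" and f = rfact and n = "m + 1"]
      by (simp add: algebra_simps)
    have r: "rfact (Y + 2 * int m + 1) = (y + 2 * M) * rfact (Y + 2 * int m + 2)"
      using rfact_rec[of "Y + 2 * int m + 2"] X Y by (simp add: x_def y_def M_def algebra_simps)
    show ?thesis unfolding q p r by (simp only: mult_ac)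
  qed
  have g1: "reduced_product (m + 1) (X) (Y) = ?a (m + 1) * prod2 ifact (m + 1) (X + Y - int m - 1) * poch3 (m + 1) (Y - X)
      * poch3 (m + 1) (X + 2 * Y) * prod2 rfact (m + 1) (X - int m) * prod1 rfact (m + 1) (Y + int m)"
    by (rule reduced_product_eq) auto
  have g2: "reduced_product (m + 1) (X - 1) (Y + 2) = ?a (m + 1) * prod2 ifact (m + 1) (X + Y - int m) * poch3 (m + 1) (Y - X + 3)
      * poch3 (m + 1) (X + 2 * Y + 3) * prod2 rfact (m + 1) (X - int m - 1) * prod1 rfact (m + 1) (Y + int m + 2)"
    by (rule reduced_product_eq) auto
  have g3: "reduced_product (m + 1) (X - 2) (Y + 1) = ?a (m + 1) * prod2 ifact (m + 1) (X + Y - int m - 2) * poch3 (m + 1) (Y - X + 3)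
      * poch3 (m + 1) (X + 2 * Y) * prod2 rfact (m + 1) (X - int m - 2) * prod1 rfact (m + 1) (Y + int m + 1)"
    by (rule reduced_product_eq) auto
  have g4: "reduced_product (m + 1) (X + 1) (Y + 1) = ?a (m + 1) * prod2 ifact (m + 1) (X + Y - int m + 1) * poch3 (m + 1) (Y - X)
      * poch3 (m + 1) (X + 2 * Y + 3) * prod2 rfact (m + 1) (X - int m + 1) * prod1 rfact (m + 1) (Y + int m + 1)"
    by (rule reduced_product_eq) auto
  have g5: "reduced_product (m + 2) (X) (Y) = ?a (m + 2) * prod2 ifact (m + 2) (X + Y - int m - 2) * poch3 (m + 2) (Y - X)
      * poch3 (m + 2) (X + 2 * Y) * prod2 rfact (m + 2) (X - int m - 1) * prod1 rfact (m + 2) (Y + int m + 1)"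
    by (rule reduced_product_eq) auto
  have g6: "reduced_product (m) (X - 1) (Y + 2) = ?a (m) * prod2 ifact (m) (X + Y - int m + 1) * poch3 (m) (Y - X + 3)
      * poch3 (m) (X + 2 * Y + 3) * prod2 rfact (m) (X - int m) * prod1 rfact (m) (Y + int m + 1)"
    by (rule reduced_product_eq) auto
  define K where "K = reduced_product (m + 2) X Y * reduced_product m (X - 1) (Y + 2)"
  \<comment> \<open>The common denominator of the two quotients; it is positive because \<open>X < Y\<close>.\<close>
  define L where "L = M * (y - x + M) * (x + 2 * y + M)"
  have "L > 0" using X Y XY by (auto simp: L_def M_def x_def y_def intro!: mult_pos_pos)
  have "reduced_product (m + 1) X Y * reduced_product (m + 1) (X - 1) (Y + 2) * L =
    (?a (m + 1) * ?a (m + 1) * M)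
    * (prod2 ifact (m + 1) (X + Y - int m - 1) * prod2 ifact (m + 1) (X + Y - int m))
    * (poch3 (m + 1) (Y - X) * poch3 (m + 1) (Y - X + 3) * (y - x + M))
    * (poch3 (m + 1) (X + 2 * Y) * poch3 (m + 1) (X + 2 * Y + 3) * (x + 2 * y + M))
    * (prod2 rfact (m + 1) (X - int m) * prod2 rfact (m + 1) (X - int m - 1))
    * (prod1 rfact (m + 1) (Y + int m) * prod1 rfact (m + 1) (Y + int m + 2))"
    unfolding g1 g2 L_def by (simp only: mult_ac)
  also have "\<dots> = (x + y - M) * (x + M) * (y + M) * K"
    unfolding a b1 c d e1 f1 unfolding K_def g5 g6
    by (simp only: mult_ac)
  finally have 1: "reduced_product (m + 1) X Y * reduced_product (m + 1) (X - 1) (Y + 2) * L =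
      (x + y - M) * (x + M) * (y + M) * K" .
  have "reduced_product (m + 1) (X - 2) (Y + 1) * reduced_product (m + 1) (X + 1) (Y + 1) * L =
    (?a (m + 1) * ?a (m + 1) * M)
    * (prod2 ifact (m + 1) (X + Y - int m - 2) * prod2 ifact (m + 1) (X + Y - int m + 1))
    * (poch3 (m + 1) (Y - X) * poch3 (m + 1) (Y - X + 3) * (y - x + M))
    * (poch3 (m + 1) (X + 2 * Y) * poch3 (m + 1) (X + 2 * Y + 3) * (x + 2 * y + M))
    * (prod2 rfact (m + 1) (X - int m - 2) * prod2 rfact (m + 1) (X - int m + 1))
    * (prod1 rfact (m + 1) (Y + int m + 1) * prod1 rfact (m + 1) (Y + int m + 1))"
    unfolding g3 g4 L_def by (simp only: mult_ac)
  also have "\<dots> = (x + y + M) * (x - M) * (y + 2 * M) * K"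
    unfolding a b2 c d e2 f2 unfolding K_def g5 g6
    by (simp only: mult_ac)
  finally have 2: "reduced_product (m + 1) (X - 2) (Y + 1) * reduced_product (m + 1) (X + 1) (Y + 1) * L =
      (x + y + M) * (x - M) * (y + 2 * M) * K" .
  have "(reduced_product (m + 1) X Y * reduced_product (m + 1) (X - 1) (Y + 2)
       - reduced_product (m + 1) (X - 2) (Y + 1) * reduced_product (m + 1) (X + 1) (Y + 1)) * L = L * K"
    unfolding left_diff_distrib 1 2 unfolding L_def condense_coeff[symmetric]
    by (simp only: left_diff_distrib)
  then show ?thesis using \<open>L > 0\<close> by (simp add: K_def)
qed

lemma reduced_product_pos:
  assumes "int n \<le> X + 1" "1 \<le> Y" "X < Y"
  shows "reduced_product n X Y > 0"
  unfolding reduced_product_def prod1_def prod2_def using assms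
  by (intro mult_pos_pos prod_pos poch3_pos) (auto intro!: ifact_pos rfact_pos)

text \<open>Dodgson condensation: the minors in the Desnanot-Jacobi identity are determinants of the
same form with shifted parameters.  One of the shifts is \<open>X - 2\<close> with the size reduced by one, so
the induction has to include the degenerate parameter \<open>X = n - 2\<close>, where both sides vanish for \<open>n > 0\<close>.\<close>

theorem det_reduced_entry:
  assumes "int n - 2 \<le> X" "1 \<le> Y" "X < Y"
  shows "detf n (reduced_entry X Y) = reduced_product n X Y"
  using assms
proof (induction n arbitrary: X Y rule: less_induct)
  case (less n)
  consider "n = 0" | "0 < n" "X = int n - 2" | "n = 1" "int n - 1 \<le> X"
    | m where "n = m + 2" "int n - 1 \<le> X"
  proof -
    have "n = 0 \<or> 0 < n \<and> X = int n - 2 \<or> (n = 1 \<or> 2 \<le> n) \<and> int n - 1 \<le> X"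
      using less.prems(1) by linarith
    then show thesis
      using that le_Suc_ex[of 2 n] by (metis add.commute)
  qed
  then show ?case
  proof cases
    case 1
    then show ?thesis by (simp add: reduced_product_def prod1_def prod2_def poch3_def)
  next
    case 2
    then have "detf n (reduced_entry X Y) = 0"
      by (intro detf_zero_row[of "n - 1"]) (auto simp: reduced_entry_def rfact_def of_nat_diff)
    moreover have "reduced_product n X Y = 0"
    proof -
      obtain k where "n = Suc k" using 2 by (cases n) auto
      then show ?thesis using 2 by (simp add: reduced_product_def prod2_first rfact_def)
    qed
    ultimately show ?thesis by simp
  next
    case 3
    have "detf 1 (reduced_entry X Y) = reduced_entry X Y 0 0"
      using detf_triangular[of 1 "reduced_entry X Y"] by simp
    also have "\<dots> = reduced_product 1 X Y"
      by (simp add: reduced_product_def prod1_def prod2_def poch3_def reduced_entry_def)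
    finally show ?thesis using 3 by simp
  next
    case 4
    have "detf (m + 2) (reduced_entry X Y) * detf m (reduced_entry (X - 1) (Y + 2)) =
      detf (m + 1) (reduced_entry X Y) * detf (m + 1) (reduced_entry (X - 1) (Y + 2))
    - detf (m + 1) (reduced_entry (X - 2) (Y + 1)) * detf (m + 1) (reduced_entry (X + 1) (Y + 1))"
    proof -
      have "(\<lambda>i j. reduced_entry X Y (Suc i) (Suc j)) = reduced_entry (X - 1) (Y + 2)"
        "(\<lambda>i j. reduced_entry X Y (Suc i) j) = reduced_entry (X - 2) (Y + 1)"
        "(\<lambda>i j. reduced_entry X Y i (Suc j)) = reduced_entry (X + 1) (Y + 1)"
        by (auto simp: fun_eq_iff reduced_entry_def algebra_simps)
      then show ?thesis using Desnanot_Jacobi[of m "reduced_entry X Y"] by simp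
    qed
    also have "detf (m + 1) (reduced_entry X Y) = reduced_product (m + 1) X Y"
      using less.prems 4 by (intro less.IH) auto
    also have "detf (m + 1) (reduced_entry (X - 1) (Y + 2)) = reduced_product (m + 1) (X - 1) (Y + 2)"
      using less.prems 4 by (intro less.IH) auto
    also have "detf (m + 1) (reduced_entry (X - 2) (Y + 1)) = reduced_product (m + 1) (X - 2) (Y + 1)"
      using less.prems 4 by (intro less.IH) auto
    also have "detf (m + 1) (reduced_entry (X + 1) (Y + 1)) = reduced_product (m + 1) (X + 1) (Y + 1)"
      using less.prems 4 by (intro less.IH) auto
    also have "detf m (reduced_entry (X - 1) (Y + 2)) = reduced_product m (X - 1) (Y + 2)"
      using less.prems 4 by (intro less.IH) auto
    finally have "detf (m + 2) (reduced_entry X Y) * reduced_product m (X - 1) (Y + 2)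
        = reduced_product (m + 2) X Y * reduced_product m (X - 1) (Y + 2)"
      using reduced_product_condense[of m X Y] less.prems 4 by simp
    moreover have "reduced_product m (X - 1) (Y + 2) > 0"
      using less.prems 4 by (intro reduced_product_pos) auto
    ultimately show ?thesis using 4 by simp
  qed
qed

section \<open>Dimer coverings and nonintersecting lattice paths\<close>

text \<open>Both kinds of triangle are indexed by their horizontal edge, from \<open>d * e + h * f\<close> to
\<open>(d + 1) * e + h * f\<close> for the lattice vectors \<open>e\<close> and \<open>f\<close>.  With this choice, an upright lozenge
consists of two triangles with the same index.\<close>

datatype tri = Up int int | Down int int

definition adjacent :: "tri set set" where
  "adjacent = {{Up d h, Down d' h'} | d h d' h'. (d', h') \<in> {(d, h), (d, h + 1), (d - 1, h + 1)}}"

definition matchings :: "tri set \<Rightarrow> tri set set set" where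
  "matchings R = {M. M \<subseteq> adjacent \<and> pairwise disjnt M \<and> \<Union> M = R}"

lemma matchings_empty: "matchings {} = {{}}"
proof -
  have "{} \<notin> adjacent" by (auto simp: adjacent_def)
  then show ?thesis by (auto simp: matchings_def)
qed

lemma finite_matchings:
  assumes "finite R"
  shows "finite (matchings R)"
proof (rule finite_subset)
  show "matchings R \<subseteq> Pow (Pow R)" by (auto simp: matchings_def)
qed (use assms in auto)

lemma adjacent_pairE:
  assumes "D \<in> adjacent" "t \<in> D"
  obtains s where "D = {s, t}" "s \<noteq> t"
  using assms unfolding adjacent_def by blast

text \<open>A given triangle is covered by a lozenge, and deleting this lozenge leaves a matching of
the rest.\<close>

lemma card_matchings:
  assumes R: "finite R" and t: "t \<in> R"
  shows "card (matchings R) = (\<Sum>s\<in>{s \<in> R. {s, t} \<in> adjacent}. card (matchings (R - {s, t})))"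
proof -
  let ?S = "{s \<in> R. {s, t} \<in> adjacent}"
  have eq: "matchings R = (\<Union>s\<in>?S. insert {s, t} ` matchings (R - {s, t}))"
  proof (intro equalityI subsetI)
    fix M assume M: "M \<in> matchings R"
    then obtain D where D: "D \<in> M" "t \<in> D" using t by (auto simp: matchings_def)
    have "D \<in> adjacent" using M D by (auto simp: matchings_def)
    then obtain s where s: "D = {s, t}" using D(2) adjacent_pairE by metis
    have "M - {D} \<in> matchings (R - {s, t})"
    proof -
      have "E \<inter> D = {}" if "E \<in> M" "E \<noteq> D" for E
        using M D(1) that by (auto simp: matchings_def pairwise_def disjnt_def)
      moreover have "\<Union> M = R" using M by (simp add: matchings_def)
      ultimately have "\<Union> (M - {D}) = R - D"
        using D(1) by blast
      moreover have "pairwise disjnt (M - {D})" "M - {D} \<subseteq> adjacent"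
        using M by (auto simp: matchings_def intro: pairwise_subset)
      ultimately show ?thesis by (simp add: matchings_def s)
    qed
    moreover have "s \<in> ?S" using M D s by (auto simp: matchings_def)
    moreover have "M = insert {s, t} (M - {D})" using D s by auto
    ultimately show "M \<in> (\<Union>s\<in>?S. insert {s, t} ` matchings (R - {s, t}))" by blast
  next
    fix M assume "M \<in> (\<Union>s\<in>?S. insert {s, t} ` matchings (R - {s, t}))"
    then obtain s N where s: "s \<in> ?S" and N: "N \<in> matchings (R - {s, t})" and M: "M = insert {s, t} N"
      by blast
    have "disjnt {s, t} D" if "D \<in> N" for D using N that by (auto simp: matchings_def disjnt_def)
    then have "pairwise disjnt M"
      using N by (auto simp: M matchings_def pairwise_insert disjnt_sym)
    moreover have "\<Union> M = R" using N s t by (auto simp: M matchings_def)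
    moreover have "M \<subseteq> adjacent" using N s by (simp add: M matchings_def)
    ultimately show "M \<in> matchings R" unfolding matchings_def by blast
  qed
  have notin: "{s, t} \<notin> N" if "N \<in> matchings (R - {s, t})" for s N
    using that by (auto simp: matchings_def)
  have "card (matchings R) = (\<Sum>s\<in>?S. card (insert {s, t} ` matchings (R - {s, t})))"
    unfolding eq
  proof (rule card_UN_disjoint)
    show "finite ?S" using R by simp
    show "\<forall>s\<in>?S. finite (insert {s, t} ` matchings (R - {s, t}))"
      using R by (auto intro: finite_matchings)
    show "\<forall>s\<in>?S. \<forall>s'\<in>?S. s \<noteq> s' \<longrightarrow>
        insert {s, t} ` matchings (R - {s, t}) \<inter> insert {s', t} ` matchings (R - {s', t}) = {}"
    proof (intro ballI impI)
      fix s s' assume *: "s \<in> ?S" "s' \<in> ?S" "s \<noteq> s'"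
      then have ne: "{s, t} \<noteq> {s', t}" by (auto simp: doubleton_eq_iff)
      have notin': "{s', t} \<notin> insert {s, t} N" if "N \<in> matchings (R - {s, t})" for N
        using that ne by (auto simp: matchings_def)
      then show "insert {s, t} ` matchings (R - {s, t}) \<inter> insert {s', t} ` matchings (R - {s', t}) = {}"
      proof (intro equals0I)
        fix M assume "M \<in> insert {s, t} ` matchings (R - {s, t}) \<inter> insert {s', t} ` matchings (R - {s', t})"
        then obtain N N' where N: "N \<in> matchings (R - {s, t})" "M = insert {s, t} N"
          and N': "M = insert {s', t} N'"
          by (elim IntE imageE) (rule that)
        have "{s', t} \<in> M" unfolding N' by (rule insertI1)
        then show False using notin'[OF N(1)] unfolding N(2) by contradiction
      qed
    qed
  qed
  also have "\<dots> = (\<Sum>s\<in>?S. card (matchings (R - {s, t})))"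
  proof (rule sum.cong)
    fix s
    have "inj_on (insert {s, t}) (matchings (R - {s, t}))"
      by (rule inj_onI) (metis insert_ident notin)
    then show "card (insert {s, t} ` matchings (R - {s, t})) = card (matchings (R - {s, t}))"
      by (rule card_image)
  qed simp
  finally show ?thesis .
qed

text \<open>The order in which the paths are arranged from right to left.  Going down, a path either
keeps its \<open>d\<close> and decreases \<open>d + h\<close>, or increases \<open>d\<close> and keeps \<open>d + h\<close>.  The weak inequalities in
both quantities therefore survive if a point of maximal height makes a step down to an edge that
is not yet taken.\<close>

definition upper_right :: "int \<times> int \<Rightarrow> int \<times> int \<Rightarrow> bool" where
  "upper_right q q' \<longleftrightarrow> fst q' \<le> fst q \<and> fst q' + snd q' \<le> fst q + snd q \<and> q \<noteq> q'"

text \<open>\<open>W\<close> is a set of horizontal edges, and \<open>Q\<close> are the end points of the paths, which carry no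
upward triangle.  The edges of height zero carry no downward triangle.\<close>

definition triangles_of :: "(int \<times> int) set \<Rightarrow> (int \<times> int) set \<Rightarrow> tri set" where
  "triangles_of W Q = (\<lambda>(d, h). Up d h) ` (W - Q) \<union> (\<lambda>(d, h). Down d h) ` {w \<in> W. 0 < snd w}"

lemma triangles_of_simps [simp]:
  "Up d h \<in> triangles_of W Q \<longleftrightarrow> (d, h) \<in> W \<and> (d, h) \<notin> Q"
  "Down d h \<in> triangles_of W Q \<longleftrightarrow> (d, h) \<in> W \<and> 0 < h"
  by (auto simp: triangles_of_def)

lemma tri_set_eqI:
  assumes "\<And>d h. Up d h \<in> A \<longleftrightarrow> Up d h \<in> B" "\<And>d h. Down d h \<in> A \<longleftrightarrow> Down d h \<in> B"
  shows "A = B"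
proof (rule Set.set_eqI)
  fix t show "t \<in> A \<longleftrightarrow> t \<in> B" by (cases t) (use assms in auto)
qed

lemma adjacent_Up_Down [simp]:
  "{Up d h, Down d' h'} \<in> adjacent \<longleftrightarrow> (d' = d \<and> h' = h) \<or> (d' = d \<and> h' = h + 1) \<or> (d' = d - 1 \<and> h' = h + 1)"
  "{Down d' h', Up d h} \<in> adjacent \<longleftrightarrow> (d' = d \<and> h' = h) \<or> (d' = d \<and> h' = h + 1) \<or> (d' = d - 1 \<and> h' = h + 1)"
  "{Up d h, Up d' h'} \<notin> adjacent"
  "{Down d h, Down d' h'} \<notin> adjacent"
  by (auto simp: adjacent_def doubleton_eq_iff)

text \<open>Induction on the number of edges, removing an edge \<open>w\<close> of maximal height.  If \<open>w\<close> is not an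
end point, its upward triangle can only be matched with its downward one, and both disappear.  If \<open>w\<close>
is an end point, its downward triangle is matched with the upward triangle of one of the two edges
below, and that edge takes the role of the end point \<open>w\<close>.  The determinant splits accordingly by
linearity in a row.  If the edge below is itself an end point or lies outside \<open>W\<close>, no matching
exists, and the determinant has two equal rows or a zero row.  Since the end points stay sorted,
they finally arrive at the bottom in their original order, so no sign appears.\<close>

theorem card_matchings_eq_det:
  fixes p :: "nat \<Rightarrow> int \<Rightarrow> int \<Rightarrow> real" and W :: "(int \<times> int) set"
  assumes W: "finite W" "\<And>d h. (d, h) \<in> W \<Longrightarrow> 0 \<le> h" "\<And>d. (d, 0) \<in> W \<longleftrightarrow> 0 \<le> d \<and> d < int n"
    and rec: "\<And>k d h. 0 < h \<Longrightarrow> p k d h = p k d (h - 1) + p k (d + 1) (h - 1)"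
    and below: "\<And>k d h. k < n \<Longrightarrow> (d, h) \<in> W \<Longrightarrow> 0 < h \<Longrightarrow> (d, h - 1) \<in> W \<or> p k d (h - 1) = 0"
      "\<And>k d h. k < n \<Longrightarrow> (d, h) \<in> W \<Longrightarrow> 0 < h \<Longrightarrow> (d + 1, h - 1) \<in> W \<or> p k (d + 1) (h - 1) = 0"
    and start: "detf n (\<lambda>i k. p k (int n - 1 - int i) 0) = 1"
    and q: "\<And>i. i < n \<Longrightarrow> q i \<in> W" "\<And>i j. i < j \<Longrightarrow> j < n \<Longrightarrow> upper_right (q i) (q j)"
  shows "real (card (matchings (triangles_of W (q ` {..<n})))) = detf n (\<lambda>i k. p k (fst (q i)) (snd (q i)))"
  using W below q
proof (induction "card W" arbitrary: W q rule: less_induct)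
  case less
  note W = less.prems(1-3) and below = less.prems(4,5) and q = less.prems(6,7)
  let ?Q = "q ` {..<n}"
  have fin: "finite (triangles_of W ?Q)" using W(1) by (simp add: triangles_of_def)
  show ?case
  proof (cases "\<exists>w\<in>W. 0 < snd w")
    case False
    then have h0: "h = 0" if "(d, h) \<in> W" for d h using W(2) that by force
    have snd_q: "snd (q i) = 0" if "i < n" for i using q(1)[OF that] h0 by (cases "q i") auto
    have fst_q: "0 \<le> fst (q i)" "fst (q i) < int n" if "i < n" for i
      using q(1)[OF that] snd_q[OF that] W(3)[of "fst (q i)"] by (cases "q i", simp)+
    have dec: "fst (q j) < fst (q i)" if "i < j" "j < n" for i j
      using q(2)[OF that] snd_q[of i] snd_q[of j] that
      by (auto simp: upper_right_def prod_eq_iff)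
    \<comment> \<open>The numbers \<open>fst (q i)\<close> are strictly decreasing and lie in \<open>{0..<n}\<close>,
      so each of them is determined by bounds from both sides.\<close>
    have lower: "int (n - 1 - i) \<le> fst (q i)" if "i < n" for i
      using that
    proof (induction "n - 1 - i" arbitrary: i)
      case 0
      then show ?case using fst_q by simp
    next
      case (Suc m)
      then have "int (n - 1 - Suc i) \<le> fst (q (Suc i))" by (intro Suc.hyps(1)) auto
      then show ?case using dec[of i "Suc i"] Suc by linarith
    qed
    have upper: "fst (q i) \<le> int n - 1 - int i" if "i < n" for i
      using that
    proof (induction i)
      case 0
      then show ?case using fst_q by fastforce
    next
      case (Suc i)
      then show ?case using dec[of i "Suc i"] by force
    qed
    have fst_eq: "fst (q i) = int n - 1 - int i" if "i < n" for i
      using lower[OF that] upper[OF that] that by linarith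
    have "W \<subseteq> ?Q"
    proof
      fix w assume "w \<in> W"
      then obtain d where d: "w = (d, 0)" "0 \<le> d" "d < int n"
        using h0 W(3) by (metis surj_pair)
      define i where "i = nat (int n - 1 - d)"
      have "i < n" "q i = w" using d fst_eq[of i] snd_q[of i] by (auto simp: i_def prod_eq_iff)
      then show "w \<in> ?Q" by auto
    qed
    then have "triangles_of W ?Q = {}" using False by (auto simp: triangles_of_def)
    moreover have "detf n (\<lambda>i k. p k (fst (q i)) (snd (q i))) = 1"
      unfolding start[symmetric] by (rule detf_cong) (simp add: fst_eq snd_q)
    ultimately show ?thesis by (simp add: matchings_empty)
  next
    case True
    \<comment> \<open>An edge of maximal height; nothing in the graph lies above it.\<close>
  define H where "H = Max (snd ` W)"
    have "H \<in> snd ` W" using True W(1) by (auto simp: H_def intro!: Max_in)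
    then obtain d where dH: "(d, H) \<in> W" by force
    have le_H: "h \<le> H" if "(d', h) \<in> W" for d' h
      unfolding H_def using that W(1) by (intro Max_ge) force+
    have H: "0 < H" using True le_H by force
    let ?W = "W - {(d, H)}"
    have card: "card ?W < card W" using W(1) dH by (rule card_Diff1_less)
    have W': "finite ?W" "\<And>d h. (d, h) \<in> ?W \<Longrightarrow> 0 \<le> h" "\<And>d. (d, 0) \<in> ?W \<longleftrightarrow> 0 \<le> d \<and> d < int n"
      using W H by auto
    have below': "(d', h - 1) \<in> ?W \<or> p k d' (h - 1) = 0" "(d' + 1, h - 1) \<in> ?W \<or> p k (d' + 1) (h - 1) = 0"
      if "k < n" "(d', h) \<in> ?W" "0 < h" for k d' h
      using below[of k d' h] that le_H[of d' h] by auto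
    show ?thesis
    proof (cases "(d, H) \<in> ?Q")
      case False
      have nbr: "{s \<in> triangles_of W ?Q. {s, Up d H} \<in> adjacent} = {Down d H}"
        using dH H le_H by (intro tri_set_eqI) force+
      have "triangles_of W ?Q - {Down d H, Up d H} = triangles_of ?W ?Q"
        by (intro tri_set_eqI) auto
      then have "card (matchings (triangles_of W ?Q)) = card (matchings (triangles_of ?W ?Q))"
        using card_matchings[OF fin, of "Up d H"] dH False by (simp add: nbr)
      also have "real \<dots> = detf n (\<lambda>i k. p k (fst (q i)) (snd (q i)))"
      proof (rule less.hyps[OF card W' below'])
        fix j assume "j < n"
        then show "q j \<in> ?W" using q(1)[of j] False by (metis DiffI image_eqI lessThan_iff singletonD)
      qed (use q(2) in auto)
      finally show ?thesis .
    next
      case True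
      then obtain i where i: "i < n" "q i = (d, H)" by auto
      let ?det = "\<lambda>u. detf n (\<lambda>i' k. p k (fst ((q(i := u)) i')) (snd ((q(i := u)) i')))"
      let ?c = "\<lambda>u. if (case u of (d', h') \<Rightarrow> Up d' h') \<in> triangles_of W ?Q
         then card (matchings (triangles_of W ?Q - {case u of (d', h') \<Rightarrow> Up d' h', Down d H})) else 0"
      have sorted: "q j \<noteq> q i" if "j < n" "j \<noteq> i" for j
        using q(2)[of i j] q(2)[of j i] that i(1) by (cases "i < j") (auto simp: upper_right_def)
      have step: "real (?c u) = ?det u" if u: "u = (d, H - 1) \<or> u = (d + 1, H - 1)" for u
      proof (cases "u \<in> W")
        case False
        then have "p k (fst u) (snd u) = 0" if "k < n" for k
          using below[OF that dH H] u by auto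
        then have "?det u = 0" using i(1) by (intro detf_zero_row[of i]) auto
        then show ?thesis using False by (cases u) simp
      next
        case uW: True
        show ?thesis
        proof (cases "u \<in> ?Q")
          case True
          then obtain j where j: "j < n" "q j = u" by auto
          then have "j \<noteq> i" using i u by auto
          then have "?det u = 0" using i(1) j by (intro detf_equal_rows[of i n j]) auto
          then show ?thesis using True by (cases u) simp
        next
          case False
          have img: "q(i := u) ` {..<n} = insert u (?Q - {(d, H)})"
          proof -
            have "inj_on q {..<n}"
            proof (rule inj_onI, rule ccontr)
              fix j l assume "j \<in> {..<n}" "l \<in> {..<n}" "q j = q l" "j \<noteq> l"
              then show False
                using q(2)[of j l] q(2)[of l j] by (cases "j < l") (auto simp: upper_right_def)
            qed
            then have "q ` ({..<n} - {i}) = ?Q - {q i}"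
              using inj_on_image_set_diff[of q "{..<n}" "{..<n}" "{i}"] i(1) by simp
            moreover have "q(i := u) ` {..<n} = insert u (q ` ({..<n} - {i}))"
              using i(1) by (auto simp: image_iff fun_upd_def split: if_splits)
            ultimately show ?thesis using i by simp
          qed
          have "triangles_of W ?Q - {case u of (d', h') \<Rightarrow> Up d' h', Down d H} = triangles_of ?W (q(i := u) ` {..<n})"
            unfolding img using True by (cases u, intro tri_set_eqI) auto
          then have "?c u = card (matchings (triangles_of ?W (q(i := u) ` {..<n})))"
            using uW False by (cases u) simp
          also have "real \<dots> = ?det u"
          proof (rule less.hyps[OF card W' below'])
            fix j assume "j < n"
            then show "(q(i := u)) j \<in> ?W" using q(1)[of j] sorted[of j] uW u i by auto
          next
            fix j l assume jl: "j < l" "l < n"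
            show "upper_right ((q(i := u)) j) ((q(i := u)) l)"
            proof (cases "j = i")
              case True
              have "u \<noteq> q l" using False jl by auto
              then show ?thesis using q(2)[OF jl] u i True jl le_H[of "fst (q l)" "snd (q l)"] q(1)[of l]
                by (cases "q l") (auto simp: upper_right_def)
            next
              case ji: False
              have "u \<noteq> q j" using False jl by auto
              then show ?thesis using q(2)[OF jl] u i ji jl le_H[of "fst (q j)" "snd (q j)"] q(1)[of j]
                by (cases "q j") (auto simp: upper_right_def)
            qed
          qed auto
          finally show ?thesis .
        qed
      qed
      have nbr: "{s \<in> triangles_of W ?Q. {s, Down d H} \<in> adjacent}
          = {Up d (H - 1), Up (d + 1) (H - 1)} \<inter> triangles_of W ?Q"
        using True by (intro tri_set_eqI) auto
      have "card (matchings (triangles_of W ?Q)) =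
          (\<Sum>s\<in>{Up d (H - 1), Up (d + 1) (H - 1)} \<inter> triangles_of W ?Q. card (matchings (triangles_of W ?Q - {s, Down d H})))"
        using card_matchings[OF fin, of "Down d H"] dH H by (simp only: nbr triangles_of_simps)
      also have "\<dots> = (\<Sum>s\<in>{Up d (H - 1), Up (d + 1) (H - 1)}.
          if s \<in> triangles_of W ?Q then card (matchings (triangles_of W ?Q - {s, Down d H})) else 0)"
        by (rule sum.inter_restrict) simp
      also have "\<dots> = ?c (d, H - 1) + ?c (d + 1, H - 1)" by simp
      finally have c: "card (matchings (triangles_of W ?Q)) = ?c (d, H - 1) + ?c (d + 1, H - 1)" .
      have c1: "real (?c (d, H - 1)) = ?det (d, H - 1)" by (rule step) simp
      have c2: "real (?c (d + 1, H - 1)) = ?det (d + 1, H - 1)" by (rule step) simp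
      have "real (card (matchings (triangles_of W ?Q))) = ?det (d, H - 1) + ?det (d + 1, H - 1)"
        unfolding c of_nat_add c1 c2 ..
      also have "\<dots> = detf n (\<lambda>i k. p k (fst (q i)) (snd (q i)))"
        using i rec[OF H] by (intro detf_add_row[of i, symmetric]) auto
      finally show ?thesis .
    qed
  qed
qed

section \<open>Coordinates, generic points and lattice polygons\<close>

definition ecoord :: "real \<times> real \<Rightarrow> real" where "ecoord z = fst z - snd z / sqrt 3"
definition fcoord :: "real \<times> real \<Rightarrow> real" where "fcoord z = 2 * snd z / sqrt 3"
definition pt :: "real \<Rightarrow> real \<Rightarrow> real \<times> real" where "pt u v = u *\<^sub>R vec_e + v *\<^sub>R vec_f"

lemma ecoord_linear [simp]: "ecoord (x + y) = ecoord x + ecoord y" "ecoord (r *\<^sub>R x) = r * ecoord x" "ecoord (- x) = - ecoord x"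
    "ecoord (x - y) = ecoord x - ecoord y" "ecoord 0 = 0"
  and fcoord_linear [simp]: "fcoord (x + y) = fcoord x + fcoord y" "fcoord (r *\<^sub>R x) = r * fcoord x" "fcoord (- x) = - fcoord x"
    "fcoord (x - y) = fcoord x - fcoord y" "fcoord 0 = 0"
  by (simp_all add: ecoord_def fcoord_def diff_divide_distrib add_divide_distrib algebra_simps)

lemma coords_basis [simp]: "ecoord vec_e = 1" "fcoord vec_e = 0" "ecoord vec_f = 0" "fcoord vec_f = 1"
    "ecoord vec_g = -1" "fcoord vec_g = 1"
  by (simp_all add: ecoord_def fcoord_def vec_g_def vec_e_def vec_f_def)

lemma coords_pt [simp]: "ecoord (pt u v) = u" "fcoord (pt u v) = v"
  by (simp_all add: pt_def)

lemma pt_coords: "pt (ecoord z) (fcoord z) = z"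
  by (cases z) (simp add: pt_def ecoord_def fcoord_def vec_e_def vec_f_def)

lemma point_eqI: "ecoord x = ecoord y \<Longrightarrow> fcoord x = fcoord y \<Longrightarrow> x = y"
  by (metis pt_coords)

lemma point_eq_iff: "x = y \<longleftrightarrow> ecoord x = ecoord y \<and> fcoord x = fcoord y"
  by (metis pt_coords)

lemma continuous_coords [continuous_intros]:
  "continuous_on S ecoord" "continuous_on S fcoord"
  unfolding ecoord_def fcoord_def by (auto intro!: continuous_intros)

text \<open>Hexagons, unit triangles and staircase cells are all of this form.\<close>

definition hexagonal :: "real \<Rightarrow> real \<Rightarrow> real \<Rightarrow> real \<Rightarrow> real \<Rightarrow> real \<Rightarrow> (real \<times> real) set" where
  "hexagonal l1 u1 l2 u2 l3 u3 = {z. l1 \<le> ecoord z \<and> ecoord z \<le> u1 \<and> l2 \<le> fcoord z \<and> fcoord z \<le> u2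
     \<and> l3 \<le> ecoord z + fcoord z \<and> ecoord z + fcoord z \<le> u3}"

definition hexagonal_open :: "real \<Rightarrow> real \<Rightarrow> real \<Rightarrow> real \<Rightarrow> real \<Rightarrow> real \<Rightarrow> (real \<times> real) set" where
  "hexagonal_open l1 u1 l2 u2 l3 u3 = {z. l1 < ecoord z \<and> ecoord z < u1 \<and> l2 < fcoord z \<and> fcoord z < u2
     \<and> l3 < ecoord z + fcoord z \<and> ecoord z + fcoord z < u3}"

lemma closed_hexagonal: "closed (hexagonal l1 u1 l2 u2 l3 u3)"
  unfolding hexagonal_def
  by (intro closed_Collect_conj closed_Collect_le continuous_intros)

lemma open_hexagonal_open: "open (hexagonal_open l1 u1 l2 u2 l3 u3)"
  unfolding hexagonal_open_def
  by (intro open_Collect_conj open_Collect_less continuous_intros)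

lemma convex_halfplanes:
  "convex {z. l \<le> ecoord z}" "convex {z. ecoord z \<le> l}" "convex {z. l \<le> fcoord z}" "convex {z. fcoord z \<le> l}"
  "convex {z. l \<le> ecoord z + fcoord z}" "convex {z. ecoord z + fcoord z \<le> l}"
proof -
  have lin: "linear ecoord" "linear fcoord" "linear (\<lambda>z. ecoord z + fcoord z)"
    by (intro linearI; simp add: algebra_simps)+
  have "convex (f -` {l..})" "convex (f -` {..l})" if "linear f" for f :: "real \<times> real \<Rightarrow> real"
    using that by (auto intro: convex_linear_vimage)
  from this[OF lin(1)] this[OF lin(2)] this[OF lin(3)] show
    "convex {z. l \<le> ecoord z}" "convex {z. ecoord z \<le> l}" "convex {z. l \<le> fcoord z}" "convex {z. fcoord z \<le> l}"
    "convex {z. l \<le> ecoord z + fcoord z}" "convex {z. ecoord z + fcoord z \<le> l}"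
    by (simp_all add: vimage_def)
qed

lemma convex_hexagonal: "convex (hexagonal l1 u1 l2 u2 l3 u3)"
proof -
  have "hexagonal l1 u1 l2 u2 l3 u3 = {z. l1 \<le> ecoord z} \<inter> {z. ecoord z \<le> u1} \<inter> {z. l2 \<le> fcoord z}
     \<inter> {z. fcoord z \<le> u2} \<inter> {z. l3 \<le> ecoord z + fcoord z} \<inter> {z. ecoord z + fcoord z \<le> u3}"
    by (auto simp: hexagonal_def)
  then show ?thesis by (simp only:) (intro convex_Int convex_halfplanes)
qed

definition generic :: "(real \<times> real) set" where
  "generic = {z. ecoord z \<notin> \<int> \<and> fcoord z \<notin> \<int> \<and> ecoord z + fcoord z \<notin> \<int>}"

lemma eventually_not_int:
  fixes u c :: real
  assumes "c > 0"
  shows "eventually (\<lambda>t. u + c * t \<notin> \<int>) (at_right 0)"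
proof -
  define d where "d = (of_int \<lfloor>u\<rfloor> + 1 - u) / c"
  have "d > 0" using assms by (simp add: d_def)
  then have "eventually (\<lambda>t. t \<in> {0<..<d}) (at_right 0)"
    by (rule eventually_at_right_real)
  then show ?thesis
  proof eventually_elim
    case (elim t)
    then have "c * t < of_int \<lfloor>u\<rfloor> + 1 - u" "0 < c * t"
      using assms by (auto simp: d_def field_simps)
    then have *: "of_int \<lfloor>u\<rfloor> < u + c * t" "u + c * t < of_int \<lfloor>u\<rfloor> + 1" by linarith+
    show ?case
    proof
      assume "u + c * t \<in> \<int>"
      then obtain k where "u + c * t = of_int k" by (auto elim: Ints_cases)
      with * have "\<lfloor>u\<rfloor> < k" "k < \<lfloor>u\<rfloor> + 1" by linarith+
      then show False by simp
    qed
  qed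
qed

text \<open>Moving a point along the direction \<open>(1, 1)\<close> changes all three coordinates, and for small
positive times none of them is an integer.\<close>

lemma generic_dense:
  assumes "open S" "z \<in> S"
  shows "\<exists>w\<in>S. w \<in> generic"
proof -
  have "((\<lambda>t. z + t *\<^sub>R pt 1 1) \<longlongrightarrow> z + 0 *\<^sub>R pt 1 1) (at_right 0)"
    by (intro tendsto_intros)
  then have "eventually (\<lambda>t. z + t *\<^sub>R pt 1 1 \<in> S) (at_right 0)"
    using assms by (auto dest: topological_tendstoD)
  moreover have "eventually (\<lambda>t. ecoord z + 1 * t \<notin> \<int>) (at_right 0)"
    "eventually (\<lambda>t. fcoord z + 1 * t \<notin> \<int>) (at_right 0)"
    "eventually (\<lambda>t. (ecoord z + fcoord z) + 2 * t \<notin> \<int>) (at_right 0)"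
    by (rule eventually_not_int; simp)+
  ultimately have "eventually (\<lambda>t. z + t *\<^sub>R pt 1 1 \<in> S \<inter> generic) (at_right 0)"
    by eventually_elim (simp add: generic_def algebra_simps)
  then show ?thesis
    using eventually_happens'[OF trivial_limit_at_right_real] by blast
qed

text \<open>A convex set with interior points is contained in the closure of its interior, and generic
points are dense in the interior.\<close>

lemma hexagonal_closure_generic:
  assumes "z0 \<in> hexagonal_open l1 u1 l2 u2 l3 u3"
  shows "closure (hexagonal l1 u1 l2 u2 l3 u3 \<inter> generic) = hexagonal l1 u1 l2 u2 l3 u3"
    (is "closure (?K \<inter> generic) = ?K")
proof
  show "closure (?K \<inter> generic) \<subseteq> ?K"
    by (rule closure_minimal[OF _ closed_hexagonal]) auto
  have "hexagonal_open l1 u1 l2 u2 l3 u3 \<subseteq> interior ?K"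
    by (rule interior_maximal[OF _ open_hexagonal_open]) (auto simp: hexagonal_def hexagonal_open_def)
  then have ne: "interior ?K \<noteq> {}" using assms by auto
  have "interior ?K \<subseteq> closure (?K \<inter> generic)"
  proof
    fix z assume z: "z \<in> interior ?K"
    show "z \<in> closure (?K \<inter> generic)"
      unfolding closure_iff_nhds_not_empty
    proof (intro allI impI)
      fix A S assume "S \<subseteq> A" "open S" "z \<in> S"
      then have "\<exists>w\<in>S \<inter> interior ?K. w \<in> generic"
        using z by (intro generic_dense[of _ z]) auto
      then show "?K \<inter> generic \<inter> A \<noteq> {}"
        using \<open>S \<subseteq> A\<close> interior_subset by blast
    qed
  qed
  then have "closure (interior ?K) \<subseteq> closure (?K \<inter> generic)"
    by (rule closure_minimal) simp
  then show "?K \<subseteq> closure (?K \<inter> generic)"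
    using convex_closure_interior[OF convex_hexagonal ne] closure_subset by blast
qed

primrec tile :: "tri \<Rightarrow> (real \<times> real) set" where
  "tile (Up i j) = {z. of_int i \<le> ecoord z \<and> of_int j \<le> fcoord z \<and> ecoord z + fcoord z \<le> of_int (i + j + 1)}"
| "tile (Down d h) = {z. ecoord z \<le> of_int (d + 1) \<and> fcoord z \<le> of_int h \<and> of_int (d + h) \<le> ecoord z + fcoord z}"

text \<open>A generic sample point of a triangle.  Testing it decides whether the triangle belongs to a
union of triangles.\<close>

primrec center :: "tri \<Rightarrow> real \<times> real" where
  "center (Up i j) = pt (of_int i + 1 / 3) (of_int j + 1 / 3)"
| "center (Down d h) = pt (of_int d + 2 / 3) (of_int h - 1 / 3)"

text \<open>For a generic point this is the only unit triangle that contains it.\<close>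

definition tile_at :: "real \<times> real \<Rightarrow> tri" where
  "tile_at z = (if ecoord z + fcoord z \<le> of_int (\<lfloor>ecoord z\<rfloor> + \<lfloor>fcoord z\<rfloor> + 1)
     then Up \<lfloor>ecoord z\<rfloor> \<lfloor>fcoord z\<rfloor> else Down \<lfloor>ecoord z\<rfloor> (\<lfloor>fcoord z\<rfloor> + 1))"

lemma in_tile_at: "z \<in> tile (tile_at z)"
  by (simp add: tile_at_def)

lemma tile_hexagonal:
  "tile (Up i j) = hexagonal (of_int i) (of_int i + 1) (of_int j) (of_int j + 1) (of_int (i + j)) (of_int (i + j + 1))"
  "tile (Down d h) = hexagonal (of_int d) (of_int d + 1) (of_int h - 1) (of_int h) (of_int (d + h)) (of_int (d + h + 1))"
  by (auto simp: hexagonal_def)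

lemma generic_neq:
  assumes "z \<in> generic"
  shows "ecoord z \<noteq> of_int k" "fcoord z \<noteq> of_int k" "ecoord z + fcoord z \<noteq> of_int k"
  using assms by (auto simp: generic_def)

lemma generic_tile_unique:
  assumes "z \<in> generic" "z \<in> tile t"
  shows "t = tile_at z"
proof (cases t)
  case (Up i j)
  have "of_int i \<le> ecoord z" "of_int j \<le> fcoord z" "ecoord z + fcoord z \<le> of_int i + of_int j + 1"
    using assms Up by auto
  moreover have "ecoord z + fcoord z \<noteq> of_int (i + j + 1)" "of_int i \<noteq> ecoord z" "of_int j \<noteq> fcoord z"
    using generic_neq[OF assms(1)] by metis+
  ultimately have *: "of_int i \<le> ecoord z" "of_int j \<le> fcoord z" "ecoord z + fcoord z < of_int i + of_int j + 1"
    "of_int i < ecoord z" "of_int j < fcoord z"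
    by auto
  then have "\<lfloor>ecoord z\<rfloor> = i" "\<lfloor>fcoord z\<rfloor> = j" by linarith+
  then show ?thesis using Up * by (simp add: tile_at_def)
next
  case (Down d h)
  have "ecoord z \<le> of_int d + 1" "fcoord z \<le> of_int h" "of_int d + of_int h \<le> ecoord z + fcoord z"
    using assms Down by auto
  moreover have "ecoord z + fcoord z \<noteq> of_int (d + h)" "ecoord z \<noteq> of_int (d + 1)" "fcoord z \<noteq> of_int h"
    using generic_neq[OF assms(1)] by metis+
  ultimately have *: "ecoord z < of_int d + 1" "fcoord z < of_int h" "of_int d + of_int h < ecoord z + fcoord z"
    by auto
  then have "\<lfloor>ecoord z\<rfloor> = d" "\<lfloor>fcoord z\<rfloor> = h - 1" by linarith+
  then show ?thesis using Down * by (simp add: tile_at_def)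
qed

lemma center_in_tile: "center s \<in> tile t \<longleftrightarrow> s = t"
proof -
  have "center s \<in> generic"
  proof -
    have *: "of_int k + 1 / 3 \<notin> (\<int> :: real set)" "of_int k + 2 / 3 \<notin> (\<int> :: real set)" for k
    proof -
      have "real_of_int k + 1 / 3 \<noteq> of_int m" "real_of_int k + 2 / 3 \<noteq> of_int m" for m
      proof -
        have "3 * k + 1 \<noteq> 3 * m" "3 * k + 2 \<noteq> 3 * m" by presburger+
        then have "real_of_int (3 * k + 1) \<noteq> of_int (3 * m)" "real_of_int (3 * k + 2) \<noteq> of_int (3 * m)"
          by (simp_all only: of_int_eq_iff not_False_eq_True)
        then show "real_of_int k + 1 / 3 \<noteq> of_int m" "real_of_int k + 2 / 3 \<noteq> of_int m" by auto
      qed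
      then show "of_int k + 1 / 3 \<notin> (\<int> :: real set)" "of_int k + 2 / 3 \<notin> (\<int> :: real set)"
        by (auto elim!: Ints_cases)
    qed
    show ?thesis
    proof (cases s)
      case (Up i j)
      then show ?thesis using *(1)[of i] *(1)[of j] *(2)[of "i + j"]
        by (simp add: generic_def algebra_simps)
    next
      case (Down d h)
      then show ?thesis using *(2)[of d] *(2)[of "h - 1"] *(1)[of "d + h"]
        by (simp add: generic_def algebra_simps)
    qed
  qed
  moreover have "center t \<in> tile t" for t by (cases t) simp_all
  ultimately show ?thesis by (metis generic_tile_unique)
qed

lemma center_in_interior: "center t \<in> interior (tile t)"
proof (cases t)
  case (Up i j)
  let ?O = "hexagonal_open (of_int i) (of_int i + 1) (of_int j) (of_int j + 1) (of_int (i + j)) (of_int (i + j + 1))"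
  have "?O \<subseteq> interior (tile t)"
    unfolding Up by (rule interior_maximal[OF _ open_hexagonal_open]) (auto simp: hexagonal_open_def)
  moreover have "center t \<in> ?O" by (simp add: Up hexagonal_open_def)
  ultimately show ?thesis by blast
next
  case (Down d h)
  let ?O = "hexagonal_open (of_int d) (of_int d + 1) (of_int h - 1) (of_int h) (of_int (d + h)) (of_int (d + h + 1))"
  have "?O \<subseteq> interior (tile t)"
    unfolding Down by (rule interior_maximal[OF _ open_hexagonal_open]) (auto simp: hexagonal_open_def)
  moreover have "center t \<in> ?O" by (simp add: Down hexagonal_open_def)
  ultimately show ?thesis by blast
qed

lemma tile_closure_generic: "closure (tile t \<inter> generic) = tile t"
proof (cases t)
  case (Up i j)
  show ?thesis unfolding Up tile_hexagonal
    by (rule hexagonal_closure_generic[of "center t"]) (simp add: Up hexagonal_open_def)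
next
  case (Down d h)
  show ?thesis unfolding Down tile_hexagonal
    by (rule hexagonal_closure_generic[of "center t"]) (simp add: Down hexagonal_open_def)
qed

definition region :: "tri set \<Rightarrow> (real \<times> real) set" where
  "region T = \<Union> (tile ` T)"

lemma center_in_region: "center t \<in> region T \<longleftrightarrow> t \<in> T"
  by (auto simp: region_def center_in_tile)

lemma region_inject: "region S = region T \<longleftrightarrow> S = T"
  by (metis center_in_region subsetI subset_antisym)

lemma region_Union: "region (\<Union> M) = \<Union> (region ` M)"
  by (auto simp: region_def)

lemma region_Un: "region (S \<union> T) = region S \<union> region T"
  by (auto simp: region_def)

lemma closed_tile: "closed (tile t)"
  by (metis tile_closure_generic closed_closure)

lemma closed_region: "finite T \<Longrightarrow> closed (region T)"
  unfolding region_def by (rule closed_UN) (auto simp: closed_tile)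

lemma generic_in_region: "z \<in> generic \<Longrightarrow> z \<in> region T \<longleftrightarrow> tile_at z \<in> T"
  unfolding region_def using generic_tile_unique in_tile_at by blast

text \<open>A common interior point would give a common generic point, whose triangle lies in both index
sets; conversely, the center of a common triangle is interior to both regions.\<close>

lemma interiors_disjoint_iff:
  "interior (region S) \<inter> interior (region T) = {} \<longleftrightarrow> S \<inter> T = {}"
proof
  assume "S \<inter> T = {}"
  show "interior (region S) \<inter> interior (region T) = {}"
  proof (rule ccontr)
    assume "interior (region S) \<inter> interior (region T) \<noteq> {}"
    then obtain z where "z \<in> interior (region S) \<inter> interior (region T)" by blast
    then obtain w where w: "w \<in> interior (region S) \<inter> interior (region T)" "w \<in> generic"
      using generic_dense[of "interior (region S) \<inter> interior (region T)" z] by blast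
    then have "w \<in> region S" "w \<in> region T" using interior_subset by blast+
    then show False using generic_in_region[OF w(2)] \<open>S \<inter> T = {}\<close> by auto
  qed
next
  have "center t \<in> interior (region S)" if "t \<in> S" for t S
  proof -
    have "interior (tile t) \<subseteq> interior (region S)"
      using that by (intro interior_mono) (auto simp: region_def)
    then show ?thesis using center_in_interior by blast
  qed
  then show "interior (region S) \<inter> interior (region T) = {} \<Longrightarrow> S \<inter> T = {}" by blast
qed

text \<open>The removed triangles take away parts of the boundary of the remaining ones, but no generic
points.\<close>

lemma closure_region_diff:
  assumes "finite S"
  shows "closure (region S - region T) = region (S - T)"
proof
  have "region S - region T \<subseteq> region (S - T)" by (auto simp: region_def)
  then show "closure (region S - region T) \<subseteq> region (S - T)"
    using assms by (intro closure_minimal closed_region) auto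
  have "tile t \<subseteq> closure (region S - region T)" if "t \<in> S - T" for t
  proof -
    have "tile t \<inter> generic \<subseteq> region S - region T"
    proof
      fix z assume z: "z \<in> tile t \<inter> generic"
      then have "t = tile_at z" using generic_tile_unique by auto
      then show "z \<in> region S - region T" using z that generic_in_region[of z] by auto
    qed
    then show ?thesis using closure_mono tile_closure_generic by metis
  qed
  then show "region (S - T) \<subseteq> closure (region S - region T)" by (auto simp: region_def)
qed

definition lattice_hexagon :: "int \<Rightarrow> int \<Rightarrow> int \<Rightarrow> int \<Rightarrow> int \<Rightarrow> int \<Rightarrow> tri set" where
  "lattice_hexagon l1 u1 l2 u2 l3 u3 =
     {Up i j | i j. l1 \<le> i \<and> i < u1 \<and> l2 \<le> j \<and> j < u2 \<and> l3 \<le> i + j \<and> i + j < u3} \<union>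
     {Down d h | d h. l1 \<le> d \<and> d < u1 \<and> l2 < h \<and> h \<le> u2 \<and> l3 \<le> d + h \<and> d + h < u3}"

lemma lattice_hexagon_simps [simp]:
  "Up i j \<in> lattice_hexagon l1 u1 l2 u2 l3 u3 \<longleftrightarrow>
     l1 \<le> i \<and> i < u1 \<and> l2 \<le> j \<and> j < u2 \<and> l3 \<le> i + j \<and> i + j < u3"
  "Down d h \<in> lattice_hexagon l1 u1 l2 u2 l3 u3 \<longleftrightarrow>
     l1 \<le> d \<and> d < u1 \<and> l2 < h \<and> h \<le> u2 \<and> l3 \<le> d + h \<and> d + h < u3"
  by (auto simp: lattice_hexagon_def)

lemma finite_lattice_hexagon: "finite (lattice_hexagon l1 u1 l2 u2 l3 u3)"
proof (rule finite_subset)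
  show "lattice_hexagon l1 u1 l2 u2 l3 u3 \<subseteq>
      (\<lambda>(i, j). Up i j) ` ({l1..u1} \<times> {l2..u2}) \<union> (\<lambda>(i, j). Down i j) ` ({l1..u1} \<times> {l2..u2})"
    by (auto simp: lattice_hexagon_def)
qed auto

text \<open>A triangle that contains a generic point of the polygon lies entirely in it, because
the sides of the polygon are lattice lines.\<close>

lemma hexagonal_region:
  assumes "z0 \<in> hexagonal_open (of_int l1) (of_int u1) (of_int l2) (of_int u2) (of_int l3) (of_int u3)"
  shows "hexagonal (of_int l1) (of_int u1) (of_int l2) (of_int u2) (of_int l3) (of_int u3)
      = region (lattice_hexagon l1 u1 l2 u2 l3 u3)" (is "?K = region ?T")
proof
  have "?K \<inter> generic \<subseteq> region ?T"
  proof
    fix z assume z: "z \<in> ?K \<inter> generic"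
    then have ne: "ecoord z \<noteq> of_int k" "fcoord z \<noteq> of_int k" "ecoord z + fcoord z \<noteq> of_int k" for k
      using generic_neq by auto
    have "tile_at z \<in> ?T"
      using z ne(1)[of u1] ne(2)[of u2] ne(3)[of u3] ne(3)[of "\<lfloor>ecoord z\<rfloor> + \<lfloor>fcoord z\<rfloor> + 1"]
      unfolding tile_at_def hexagonal_def by (auto simp: le_floor_iff floor_less_iff) linarith+
    then show "z \<in> region ?T" using generic_in_region z by blast
  qed
  then have "closure (?K \<inter> generic) \<subseteq> region ?T"
    by (intro closure_minimal closed_region finite_lattice_hexagon)
  then show "?K \<subseteq> region ?T" by (simp only: hexagonal_closure_generic[OF assms])
  have "tile t \<subseteq> ?K" if "t \<in> ?T" for t
  proof (cases t)
    case (Up i j)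
    then have "real_of_int l1 \<le> of_int i" "real_of_int (i + 1) \<le> of_int u1"
      "real_of_int l2 \<le> of_int j" "real_of_int (j + 1) \<le> of_int u2"
      "real_of_int l3 \<le> of_int (i + j)" "real_of_int (i + j + 1) \<le> of_int u3"
      using that unfolding of_int_le_iff by auto
    then show ?thesis by (auto simp: Up hexagonal_def)
  next
    case (Down d h)
    then have "real_of_int l1 \<le> of_int d" "real_of_int (d + 1) \<le> of_int u1"
      "real_of_int (l2 + 1) \<le> of_int h" "real_of_int h \<le> of_int u2"
      "real_of_int l3 \<le> of_int (d + h)" "real_of_int (d + h + 1) \<le> of_int u3"
      using that unfolding of_int_le_iff by auto
    then show ?thesis by (auto simp: Down hexagonal_def)
  qed
  then show "region ?T \<subseteq> ?K" by (auto simp: region_def)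
qed

section \<open>Lozenge tilings of a union of unit triangles\<close>

lemma pt_in_tile:
  "pt (of_int i) (of_int j) \<in> tile (Up a b) \<longleftrightarrow> a \<le> i \<and> b \<le> j \<and> i + j \<le> a + b + 1"
  "pt (of_int i) (of_int j) \<in> tile (Down a b) \<longleftrightarrow> i \<le> a + 1 \<and> j \<le> b \<and> a + b \<le> i + j"
proof -
  have "real_of_int i + real_of_int j \<le> real_of_int a + real_of_int b + 1 \<longleftrightarrow> i + j \<le> a + b + 1"
    by linarith
  moreover have "real_of_int a + real_of_int b \<le> real_of_int i + real_of_int j \<longleftrightarrow> a + b \<le> i + j"
    "real_of_int i \<le> real_of_int a + 1 \<longleftrightarrow> i \<le> a + 1"
    by linarith+
  ultimately show "pt (of_int i) (of_int j) \<in> tile (Up a b) \<longleftrightarrow> a \<le> i \<and> b \<le> j \<and> i + j \<le> a + b + 1"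
    "pt (of_int i) (of_int j) \<in> tile (Down a b) \<longleftrightarrow> i \<le> a + 1 \<and> j \<le> b \<and> a + b \<le> i + j"
    by simp_all
qed

lemma lattice_eq: "Defs.lattice = {pt (of_int i) (of_int j) | i j. True}"
  by (simp add: Defs.lattice_def pt_def)

lemma tile_hull:
  fixes i j :: int
  defines "p \<equiv> pt (of_int i) (of_int j)"
  shows "convex hull {p, p + vec_e, p + vec_f} = tile (Up i j)"
    and "convex hull {p, p + vec_f, p + vec_g} = tile (Down (i - 1) (j + 1))"
proof -
  have p: "ecoord p = of_int i" "fcoord p = of_int j" by (simp_all add: p_def)
  show "convex hull {p, p + vec_e, p + vec_f} = tile (Up i j)" (is "?H = ?T")
  proof
    have "convex ?T" unfolding tile_hexagonal by (rule convex_hexagonal)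
    then show "?H \<subseteq> ?T" by (intro hull_minimal) (auto simp: p)
    show "?T \<subseteq> ?H"
    proof
      fix z assume z: "z \<in> ?T"
      let ?u = "ecoord z - of_int i" and ?v = "fcoord z - of_int j"
      have "z = (1 - ?u - ?v) *\<^sub>R p + ?u *\<^sub>R (p + vec_e) + ?v *\<^sub>R (p + vec_f)"
        by (rule point_eqI) (simp_all add: p algebra_simps)
      moreover have "0 \<le> 1 - ?u - ?v" "0 \<le> ?u" "0 \<le> ?v" "(1 - ?u - ?v) + ?u + ?v = 1" using z by auto
      ultimately show "z \<in> ?H" unfolding convex_hull_3 by blast
    qed
  qed
  show "convex hull {p, p + vec_f, p + vec_g} = tile (Down (i - 1) (j + 1))" (is "?H = ?T")
  proof
    have "convex ?T" unfolding tile_hexagonal by (rule convex_hexagonal)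
    then show "?H \<subseteq> ?T" by (intro hull_minimal) (auto simp: p)
    show "?T \<subseteq> ?H"
    proof
      fix z assume z: "z \<in> ?T"
      let ?u = "of_int (j + 1) - fcoord z" and ?v = "ecoord z + fcoord z - of_int (i + j)" and ?w = "of_int i - ecoord z"
      have "z = ?u *\<^sub>R p + ?v *\<^sub>R (p + vec_f) + ?w *\<^sub>R (p + vec_g)"
        by (rule point_eqI) (simp_all add: p algebra_simps)
      moreover have "0 \<le> ?u" "0 \<le> ?v" "0 \<le> ?w" "?u + ?v + ?w = 1" using z by auto
      ultimately show "z \<in> ?H" unfolding convex_hull_3 by blast
    qed
  qed
qed

lemma unit_triangles_eq: "unit_triangles = range tile"
proof -
  have "unit_triangles = {tile (Up i j) | i j. True} \<union> {tile (Down (i - 1) (j + 1)) | i j. True}"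
    unfolding unit_triangles_def lattice_eq tile_hull[symmetric]
    by (intro arg_cong2[of _ _ _ _ "(\<union>)"]) blast+
  also have "\<dots> = range tile"
  proof
    show "range tile \<subseteq> {tile (Up i j) | i j. True} \<union> {tile (Down (i - 1) (j + 1)) | i j. True}"
    proof
      fix S assume "S \<in> range tile"
      then obtain t where t: "S = tile t" by blast
      show "S \<in> {tile (Up i j) | i j. True} \<union> {tile (Down (i - 1) (j + 1)) | i j. True}"
      proof (cases t)
        case (Down d h)
        then have "S = tile (Down ((d + 1) - 1) ((h - 1) + 1))" by (simp add: t)
        then show ?thesis by blast
      qed (use t in blast)
    qed
  qed blast
  finally show ?thesis .
qed

lemma in_closed_segment_coords:
  "z \<in> closed_segment p q \<longleftrightarrow> (\<exists>t. 0 \<le> t \<and> t \<le> 1 \<and>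
     ecoord z = (1 - t) * ecoord p + t * ecoord q \<and> fcoord z = (1 - t) * fcoord p + t * fcoord q)"
  by (auto simp: in_segment point_eq_iff[of z])

lemma tile_inter_adjacent:
  "tile (Up d h) \<inter> tile (Down d h) =
     closed_segment (pt (of_int d) (of_int h)) (pt (of_int (d + 1)) (of_int h))"
  "tile (Up d h) \<inter> tile (Down d (h + 1)) =
     closed_segment (pt (of_int (d + 1)) (of_int h)) (pt (of_int d) (of_int (h + 1)))"
  "tile (Up d h) \<inter> tile (Down (d - 1) (h + 1)) =
     closed_segment (pt (of_int d) (of_int h)) (pt (of_int d) (of_int (h + 1)))"
proof -
  show "tile (Up d h) \<inter> tile (Down d h) =
     closed_segment (pt (of_int d) (of_int h)) (pt (of_int (d + 1)) (of_int h))"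
  proof (rule Set.set_eqI)
    fix z
    show "z \<in> tile (Up d h) \<inter> tile (Down d h) \<longleftrightarrow>
      z \<in> closed_segment (pt (of_int d) (of_int h)) (pt (of_int (d + 1)) (of_int h))"
      unfolding in_closed_segment_coords
      by (auto simp: algebra_simps intro!: exI[of _ "ecoord z - of_int d"])
  qed
  show "tile (Up d h) \<inter> tile (Down d (h + 1)) =
     closed_segment (pt (of_int (d + 1)) (of_int h)) (pt (of_int d) (of_int (h + 1)))"
  proof (rule Set.set_eqI)
    fix z
    show "z \<in> tile (Up d h) \<inter> tile (Down d (h + 1)) \<longleftrightarrow>
      z \<in> closed_segment (pt (of_int (d + 1)) (of_int h)) (pt (of_int d) (of_int (h + 1)))"
      unfolding in_closed_segment_coords
      by (auto simp: algebra_simps intro!: exI[of _ "fcoord z - of_int h"])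
  qed
  show "tile (Up d h) \<inter> tile (Down (d - 1) (h + 1)) =
     closed_segment (pt (of_int d) (of_int h)) (pt (of_int d) (of_int (h + 1)))"
  proof (rule Set.set_eqI)
    fix z
    show "z \<in> tile (Up d h) \<inter> tile (Down (d - 1) (h + 1)) \<longleftrightarrow>
      z \<in> closed_segment (pt (of_int d) (of_int h)) (pt (of_int d) (of_int (h + 1)))"
      unfolding in_closed_segment_coords
      by (auto simp: algebra_simps intro!: exI[of _ "fcoord z - of_int h"])
  qed
qed

lemma norm_basis: "norm vec_e = 1" "norm vec_f = 1" "norm vec_g = 1"
  by (simp_all add: vec_e_def vec_f_def vec_g_def norm_Pair power_divide)

lemma share_edge_commute: "share_edge S T \<longleftrightarrow> share_edge T S"
  by (simp add: share_edge_def Int_commute)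

lemma share_edge_Up_Down:
  assumes "{Up i j, Down d h} \<in> adjacent"
  shows "share_edge (tile (Up i j)) (tile (Down d h))"
proof -
  have "pt (of_int k) (of_int l) \<in> Defs.lattice" for k l by (auto simp: lattice_eq)
  note lat = this
  have "d = i \<and> h = j \<or> d = i \<and> h = j + 1 \<or> d = i - 1 \<and> h = j + 1" using assms by simp
  then show ?thesis
  proof (elim disjE conjE)
    assume dh: "d = i" "h = j"
    have "pt (of_int i) (of_int j) - pt (of_int (i + 1)) (of_int j) = - vec_e"
      by (rule point_eqI) simp_all
    then have "dist (pt (of_int i) (of_int j)) (pt (of_int (i + 1)) (of_int j)) = 1"
      by (simp only: dist_norm norm_minus_cancel norm_basis)
    then show ?thesis
      unfolding share_edge_def dh using lat tile_inter_adjacent(1)[of i j] by blast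
  next
    assume dh: "d = i" "h = j + 1"
    have "pt (of_int (i + 1)) (of_int j) - pt (of_int i) (of_int (j + 1)) = - vec_g"
      by (rule point_eqI) simp_all
    then have "dist (pt (of_int (i + 1)) (of_int j)) (pt (of_int i) (of_int (j + 1))) = 1"
      by (simp only: dist_norm norm_minus_cancel norm_basis)
    then show ?thesis
      unfolding share_edge_def dh using lat tile_inter_adjacent(2)[of i j] by blast
  next
    assume dh: "d = i - 1" "h = j + 1"
    have "pt (of_int i) (of_int j) - pt (of_int i) (of_int (j + 1)) = - vec_f"
      by (rule point_eqI) simp_all
    then have "dist (pt (of_int i) (of_int j)) (pt (of_int i) (of_int (j + 1))) = 1"
      by (simp only: dist_norm norm_minus_cancel norm_basis)
    then show ?thesis
      unfolding share_edge_def dh using lat tile_inter_adjacent(3)[of i j] by blast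
  qed
qed

text \<open>The end points of a shared edge are two common lattice points of the triangles, and the
lattice points of a unit triangle are its vertices.  Equal triangles are excluded because their
intersection has interior points.\<close>

lemma share_edge_iff: "share_edge (tile s) (tile t) \<longleftrightarrow> {s, t} \<in> adjacent"
proof
  assume "{s, t} \<in> adjacent"
  then show "share_edge (tile s) (tile t)"
  proof (cases s; cases t)
    fix a b a' b' assume "s = Down a b" "t = Up a' b'" "{s, t} \<in> adjacent"
    then show ?thesis
      using share_edge_Up_Down[of a' b' a b] by (simp only: share_edge_commute insert_commute)
  qed (simp_all only: share_edge_Up_Down adjacent_Up_Down)
next
  assume "share_edge (tile s) (tile t)"
  then obtain u v where uv: "u \<in> Defs.lattice" "v \<in> Defs.lattice" "dist u v = 1"
    "tile s \<inter> tile t = closed_segment u v"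
    unfolding share_edge_def by blast
  obtain i j where u: "u = pt (of_int i) (of_int j)" using uv(1) unfolding lattice_eq by blast
  obtain i' j' where v: "v = pt (of_int i') (of_int j')" using uv(2) unfolding lattice_eq by blast
  have eq: "tile s \<inter> tile t = closed_segment (pt (of_int i) (of_int j)) (pt (of_int i') (of_int j'))"
    using uv(4) by (simp only: u v)
  have ne: "i \<noteq> i' \<or> j \<noteq> j'" using uv(3) by (auto simp: u v)
  have "pt (of_int i) (of_int j) \<in> tile s \<inter> tile t" "pt (of_int i') (of_int j') \<in> tile s \<inter> tile t"
    unfolding eq by simp_all
  then have mem: "pt (of_int i) (of_int j) \<in> tile s" "pt (of_int i) (of_int j) \<in> tile t"
    "pt (of_int i') (of_int j') \<in> tile s" "pt (of_int i') (of_int j') \<in> tile t" by auto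
  have st: "s \<noteq> t"
  proof
    assume "s = t"
    then have "interior (tile s) = {}"
      using eq by (simp add: interior_closed_segment_ge2)
    then show False using center_in_interior by auto
  qed
  show "{s, t} \<in> adjacent"
  proof (cases s; cases t)
    fix a b a' b' assume "s = Up a b" "t = Up a' b'"
    with mem st ne show ?thesis by (simp only: pt_in_tile) (simp, arith)
  next
    fix a b a' b' assume "s = Down a b" "t = Down a' b'"
    with mem st ne show ?thesis by (simp only: pt_in_tile) (simp, arith)
  next
    fix a b a' b' assume "s = Up a b" "t = Down a' b'"
    with mem st ne show ?thesis by (simp only: pt_in_tile adjacent_Up_Down) arith
  next
    fix a b a' b' assume "s = Down a b" "t = Up a' b'"
    with mem st ne show ?thesis by (simp only: pt_in_tile adjacent_Up_Down) arith
  qed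
qed

lemma lozenges_eq: "lozenges = region ` adjacent"
proof -
  have "lozenges = {tile s \<union> tile t | s t. {s, t} \<in> adjacent}"
    unfolding lozenges_def unit_triangles_eq using share_edge_iff by blast
  also have "\<dots> = {region {s, t} | s t. {s, t} \<in> adjacent}"
    by (simp add: region_def)
  also have "\<dots> = region ` adjacent"
  proof -
    have "\<exists>s t. D = {s, t}" if "D \<in> adjacent" for D using that unfolding adjacent_def by blast
    then show ?thesis by blast
  qed
  finally show ?thesis .
qed

text \<open>Union is injective on index sets of triangles, and it turns disjoint index sets into regions
with disjoint interiors.\<close>

theorem num_lozenge_tilings_region: "num_lozenge_tilings (region R) = card (matchings R)"
proof -
  have inj: "inj region" by (rule injI) (simp add: region_inject)
  have pw: "pairwise (\<lambda>A B. interior A \<inter> interior B = {}) (region ` M) \<longleftrightarrow> pairwise disjnt M" for M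
    by (auto simp: pairwise_def interiors_disjoint_iff region_inject disjnt_def)
  have "lozenge_tilings (region R) = image region ` matchings R"
  proof
    show "image region ` matchings R \<subseteq> lozenge_tilings (region R)"
    proof (rule image_subsetI)
      fix M assume "M \<in> matchings R"
      then show "region ` M \<in> lozenge_tilings (region R)"
        unfolding lozenge_tilings_def mem_Collect_eq pw lozenges_eq region_Union[symmetric]
        by (simp add: matchings_def image_mono)
    qed
    show "lozenge_tilings (region R) \<subseteq> image region ` matchings R"
    proof
      fix X assume X: "X \<in> lozenge_tilings (region R)"
      then have "X \<subseteq> region ` adjacent" by (simp add: lozenge_tilings_def lozenges_eq)
      then obtain M where M: "M \<subseteq> adjacent" "X = region ` M" by (meson subset_imageE)
      have "pairwise disjnt M" using X by (simp add: lozenge_tilings_def M(2) pw)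
      moreover have "region (\<Union> M) = region R" using X by (simp add: lozenge_tilings_def M(2) region_Union)
      ultimately show "X \<in> image region ` matchings R"
        using M by (auto simp: matchings_def region_inject)
    qed
  qed
  moreover have "inj_on (image region) (matchings R)"
    using inj by (auto simp: inj_on_def inj_image_eq_iff)
  ultimately show ?thesis by (simp add: num_lozenge_tilings_def card_image)
qed

section \<open>The hexagon with its two staircases removed\<close>

lemma convex_contains_combination:
  assumes "convex K" "pt u1 v1 \<in> K" "pt u2 v2 \<in> K" "0 \<le> t" "t \<le> 1"
    "u = (1 - t) * u1 + t * u2" "v = (1 - t) * v1 + t * v2"
  shows "pt u v \<in> K"
proof -
  have "pt u v = (1 - t) *\<^sub>R pt u1 v1 + t *\<^sub>R pt u2 v2"
    by (rule point_eqI) (simp_all add: assms)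
  then show ?thesis using assms by (simp add: convexD_alt)
qed

lemma convex_between:
  assumes "convex K" "pt u1 v \<in> K" "pt u2 v \<in> K" "u1 \<le> u" "u \<le> u2"
  shows "pt u v \<in> K"
proof (cases "u1 = u2")
  case False
  then have pos: "u2 - u1 > 0" using assms by auto
  define t where "t = (u - u1) / (u2 - u1)"
  have t: "t * (u2 - u1) = u - u1" using pos by (simp add: t_def)
  show ?thesis
  proof (rule convex_contains_combination[OF assms(1-3)])
    show "0 \<le> t" "t \<le> 1" using pos assms(4,5) by (simp_all add: t_def)
    show "u = (1 - t) * u1 + t * u2" using t by (simp add: algebra_simps)
    show "v = (1 - t) * v + t * v" by (simp add: algebra_simps)
  qed
qed (use assms in auto)

text \<open>Each horizontal chord of the hexagon has its end points on the boundary, where they are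
combinations of two adjacent vertices.\<close>

lemma hexagon_eq:
  assumes "0 < a" "0 < b" "0 < c"
  shows "hexagon a b c = hexagonal (- real c) (real b) 0 (real (a + c)) 0 (real (a + b))" (is "?H = ?K")
proof
  show "?H \<subseteq> ?K"
    unfolding hexagon_def by (intro hull_minimal convex_hexagonal) (auto simp: hexagonal_def)
  have conv: "convex ?H" unfolding hexagon_def by (rule convex_convex_hull)
  have corner: "pt 0 0 \<in> ?H" "pt (real b) 0 \<in> ?H" "pt (real b) (real a) \<in> ?H"
    "pt (real b - real c) (real a + real c) \<in> ?H" "pt (- real c) (real a + real c) \<in> ?H"
    "pt (- real c) (real c) \<in> ?H"
    unfolding hexagon_def by (rule hull_inc; simp add: point_eq_iff)+
  show "?K \<subseteq> ?H"
  proof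
    fix z assume z: "z \<in> ?K"
    define u v where "u = ecoord z" and "v = fcoord z"
    have uv: "- real c \<le> u" "u \<le> real b" "0 \<le> v" "v \<le> real a + real c" "0 \<le> u + v" "u + v \<le> real a + real b"
      using z by (auto simp: hexagonal_def u_def v_def)
    have L: "pt (max (- real c) (- v)) v \<in> ?H"
    proof (cases "v \<le> real c")
      case True
      then show ?thesis using uv assms
        by (intro convex_contains_combination[OF conv corner(1) corner(6), of "v / real c"]) (auto simp: max_def)
    next
      case False
      then show ?thesis using uv assms
        by (intro convex_contains_combination[OF conv corner(6) corner(5), of "(v - real c) / real a"])
           (auto simp: max_def field_simps)
    qed
    have R: "pt (min (real b) (real a + real b - v)) v \<in> ?H"
    proof (cases "v \<le> real a")
      case True
      then show ?thesis using uv assms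
        by (intro convex_contains_combination[OF conv corner(2) corner(3), of "v / real a"]) (auto simp: min_def field_simps)
    next
      case False
      then show ?thesis using uv assms
        by (intro convex_contains_combination[OF conv corner(3) corner(4), of "(v - real a) / real c"])
           (auto simp: min_def field_simps)
    qed
    have "pt u v \<in> ?H"
      by (rule convex_between[OF conv L R]) (use uv in auto)
    then show "z \<in> ?H" by (simp add: u_def v_def pt_coords)
  qed
qed

lemma in_staircase_cell:
  assumes "real i - 1 \<le> x" "x \<le> real i" "real j - 1 \<le> y" "y \<le> real j"
  shows "V + x *\<^sub>R s + y *\<^sub>R t \<in> staircase_cell V s t i j" (is "_ \<in> ?C")
proof -
  have conv: "convex ?C" unfolding staircase_cell_def by (rule convex_convex_hull)
  let ?u = "x - (real i - 1)" and ?v = "y - (real j - 1)"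
  have "V + x *\<^sub>R s + y' *\<^sub>R t \<in> ?C" if "y' = real j - 1 \<or> y' = real j" for y'
  proof -
    have "V + (real i - 1) *\<^sub>R s + y' *\<^sub>R t \<in> ?C" "V + real i *\<^sub>R s + y' *\<^sub>R t \<in> ?C"
      unfolding staircase_cell_def using that by (auto intro: hull_inc)
    then have "(1 - ?u) *\<^sub>R (V + (real i - 1) *\<^sub>R s + y' *\<^sub>R t) + ?u *\<^sub>R (V + real i *\<^sub>R s + y' *\<^sub>R t) \<in> ?C"
      using assms by (intro convexD_alt[OF conv]) auto
    also have "(1 - ?u) *\<^sub>R (V + (real i - 1) *\<^sub>R s + y' *\<^sub>R t) + ?u *\<^sub>R (V + real i *\<^sub>R s + y' *\<^sub>R t)
        = V + x *\<^sub>R s + y' *\<^sub>R t"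
      by (rule point_eqI) (simp_all add: algebra_simps)
    finally show ?thesis .
  qed
  then have "(1 - ?v) *\<^sub>R (V + x *\<^sub>R s + (real j - 1) *\<^sub>R t) + ?v *\<^sub>R (V + x *\<^sub>R s + real j *\<^sub>R t) \<in> ?C"
    using assms by (intro convexD_alt[OF conv]) auto
  also have "(1 - ?v) *\<^sub>R (V + x *\<^sub>R s + (real j - 1) *\<^sub>R t) + ?v *\<^sub>R (V + x *\<^sub>R s + real j *\<^sub>R t)
      = V + x *\<^sub>R s + y *\<^sub>R t"
    by (rule point_eqI) (simp_all add: algebra_simps)
  finally show ?thesis .
qed

text \<open>The cell of the staircase at the northwestern corner, a lozenge with horizontal sides.  The
last two bounds are implied by the other four.\<close>

definition nw_cell :: "nat \<Rightarrow> nat \<Rightarrow> nat \<Rightarrow> nat \<Rightarrow> tri set" where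
  "nw_cell a c i j = lattice_hexagon (int i - int c - 1) (int i - int c)
     (int a + int c - int j) (int a + int c - int j + 1) (int a + int i - int j - 1) (int a + int i - int j + 1)"

text \<open>The cell of the staircase at the eastern corner, a lozenge without horizontal sides.  The
third and the fourth bound are implied by the other four.\<close>

definition e_cell :: "nat \<Rightarrow> nat \<Rightarrow> nat \<Rightarrow> nat \<Rightarrow> tri set" where
  "e_cell a b i j = lattice_hexagon (int b - int j) (int b - int j + 1)
     (int a + int j - int i - 1) (int a + int j - int i + 1) (int a + int b - int i) (int a + int b - int i + 1)"

lemma nw_staircase_cell:
  "staircase_cell (real a *\<^sub>R vec_f + real c *\<^sub>R vec_g) vec_e (- vec_f) i j = region (nw_cell a c i j)"
    (is "?C = _")
proof -
  let ?K = "hexagonal (of_int (int i - int c - 1)) (of_int (int i - int c))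
     (of_int (int a + int c - int j)) (of_int (int a + int c - int j + 1))
     (of_int (int a + int i - int j - 1)) (of_int (int a + int i - int j + 1))"
  have "?C = ?K"
  proof
    show "?C \<subseteq> ?K" unfolding staircase_cell_def
      by (intro hull_minimal convex_hexagonal) (auto simp: hexagonal_def)
    show "?K \<subseteq> ?C"
    proof
      fix z assume z: "z \<in> ?K"
      let ?x = "ecoord z + real c" and ?y = "real a + real c - fcoord z"
      have "real a *\<^sub>R vec_f + real c *\<^sub>R vec_g + ?x *\<^sub>R vec_e + ?y *\<^sub>R (- vec_f) \<in> ?C"
        using z by (intro in_staircase_cell) (auto simp: hexagonal_def)
      also have "real a *\<^sub>R vec_f + real c *\<^sub>R vec_g + ?x *\<^sub>R vec_e + ?y *\<^sub>R (- vec_f) = z"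
        by (rule point_eqI) (simp_all add: algebra_simps)
      finally show "z \<in> ?C" .
    qed
  qed
  also have "?K = region (nw_cell a c i j)" unfolding nw_cell_def
    by (rule hexagonal_region[of "pt (real i - real c - 1 / 2) (real a + real c - real j + 1 / 2)"])
       (simp add: hexagonal_open_def)
  finally show ?thesis .
qed

lemma e_staircase_cell:
  "staircase_cell (real b *\<^sub>R vec_e + real a *\<^sub>R vec_f) (- vec_f) vec_g i j = region (e_cell a b i j)"
    (is "?C = _")
proof -
  let ?K = "hexagonal (of_int (int b - int j)) (of_int (int b - int j + 1))
     (of_int (int a + int j - int i - 1)) (of_int (int a + int j - int i + 1))
     (of_int (int a + int b - int i)) (of_int (int a + int b - int i + 1))"
  have "?C = ?K"
  proof
    show "?C \<subseteq> ?K" unfolding staircase_cell_def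
      by (intro hull_minimal convex_hexagonal) (auto simp: hexagonal_def)
    show "?K \<subseteq> ?C"
    proof
      fix z assume z: "z \<in> ?K"
      let ?x = "real a + real b - ecoord z - fcoord z" and ?y = "real b - ecoord z"
      have "real b *\<^sub>R vec_e + real a *\<^sub>R vec_f + ?x *\<^sub>R (- vec_f) + ?y *\<^sub>R vec_g \<in> ?C"
        using z by (intro in_staircase_cell) (auto simp: hexagonal_def)
      also have "real b *\<^sub>R vec_e + real a *\<^sub>R vec_f + ?x *\<^sub>R (- vec_f) + ?y *\<^sub>R vec_g = z"
        by (rule point_eqI) (simp_all add: algebra_simps)
      finally show "z \<in> ?C" .
    qed
  qed
  also have "?K = region (e_cell a b i j)" unfolding e_cell_def
    by (rule hexagonal_region[of "pt (real b - real j + 1 / 2) (real a + real j - real i)"])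
       (simp add: hexagonal_open_def)
  finally show ?thesis .
qed

text \<open>The horizontal edges of the region.  The inequality \<open>2 * d + h < 2 * b\<close> comes from the eastern
staircase, and the last one from the northwestern staircase.\<close>

definition edges :: "nat \<Rightarrow> nat \<Rightarrow> nat \<Rightarrow> (int \<times> int) set" where
  "edges a b c = {(d, h). - int c \<le> d \<and> 0 \<le> d + h \<and> d + h < int a + int b \<and> 2 * d + h < 2 * int b
     \<and> 0 \<le> h \<and> h \<le> d + int a + 2 * int c - int b + 1}"

text \<open>The horizontal edges on the boundary of the northwestern staircase together with the
remaining edge of the top side, from right to left.\<close>

definition sink :: "nat \<Rightarrow> nat \<Rightarrow> nat \<Rightarrow> nat \<Rightarrow> int \<times> int" where
  "sink a b c i = (int b - int c - 1 - int i, int a + int c - int i)"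

text \<open>The hypothesis \<open>a \<le> c\<close> makes the eastern staircase reach up to height \<open>2 * a - 1\<close>,
above which the constraint given by its zigzag boundary follows from the northeastern side.\<close>

lemma hexagon_d_eq:
  assumes "0 < a" "0 < b" "0 < c" "b \<le> a" "a \<le> c"
  shows "hexagon_d a b c = region (triangles_of (edges a b c) (sink a b c ` {..<b}))"
proof -
  let ?H = "lattice_hexagon (- int c) (int b) 0 (int (a + c)) 0 (int (a + b))"
  let ?N = "\<Union> {nw_cell a c i j | i j. 1 \<le> i \<and> 1 \<le> j \<and> i + j \<le> b}"
  let ?E = "\<Union> {e_cell a b i j | i j. 1 \<le> i \<and> 1 \<le> j \<and> i + j \<le> a}"
  have "hexagon a b c = region ?H"
    unfolding hexagon_eq[OF assms(1-3)]
    using assms hexagonal_region[of "pt (1 / 2) (1 / 4)" "- int c" "int b" 0 "int (a + c)" 0 "int (a + b)"]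
    by (simp add: hexagonal_open_def)
  moreover have "maximal_staircase (real a *\<^sub>R vec_f + real c *\<^sub>R vec_g) b vec_e a (- vec_f) = region ?N"
    using assms unfolding maximal_staircase_def nw_staircase_cell region_Union
    by (intro arg_cong[of _ _ Union]) (auto simp: min_def image_def)
  moreover have "maximal_staircase (real b *\<^sub>R vec_e + real a *\<^sub>R vec_f) a (- vec_f) c vec_g = region ?E"
    using assms unfolding maximal_staircase_def e_staircase_cell region_Union
    by (intro arg_cong[of _ _ Union]) (auto simp: min_def image_def)
  ultimately have "hexagon_d a b c = closure (region ?H - region (?N \<union> ?E))"
    by (simp only: hexagon_d_def region_Un Diff_Un Diff_Int_distrib2) (rule arg_cong[of _ _ closure], blast)
  also have "\<dots> = region (?H - (?N \<union> ?E))"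
    by (rule closure_region_diff) (rule finite_lattice_hexagon)
  also have "?H - (?N \<union> ?E) = triangles_of (edges a b c) (sink a b c ` {..<b})"
  proof (rule tri_set_eqI)
    fix d h
    have upN: "Up d h \<in> ?N \<longleftrightarrow> - int c \<le> d \<and> h < int a + int c \<and> d + int a + 2 * int c + 1 \<le> h + int b" (is "?l \<longleftrightarrow> ?r")
    proof
      assume ?r
      then have "Up d h \<in> nw_cell a c (nat (d + int c + 1)) (nat (int a + int c - h))"
        "1 \<le> nat (d + int c + 1)" "1 \<le> nat (int a + int c - h)"
        "nat (d + int c + 1) + nat (int a + int c - h) \<le> b"
        by (auto simp: nw_cell_def)
      then show ?l by blast
    qed (auto simp: nw_cell_def)
    have dnN: "Down d h \<in> ?N \<longleftrightarrow> - int c \<le> d \<and> h \<le> int a + int c \<and> d + int a + 2 * int c + 2 \<le> h + int b" (is "?l \<longleftrightarrow> ?r")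
    proof
      assume ?r
      then have "Down d h \<in> nw_cell a c (nat (d + int c + 1)) (nat (int a + int c + 1 - h))"
        "1 \<le> nat (d + int c + 1)" "1 \<le> nat (int a + int c + 1 - h)"
        "nat (d + int c + 1) + nat (int a + int c + 1 - h) \<le> b"
        by (auto simp: nw_cell_def)
      then show ?l by blast
    qed (auto simp: nw_cell_def)
    have upE: "Up d h \<in> ?E \<longleftrightarrow> d < int b \<and> d + h < int a + int b \<and> 2 * int b \<le> 2 * d + h" (is "?l \<longleftrightarrow> ?r")
    proof
      assume ?r
      then have "Up d h \<in> e_cell a b (nat (int a + int b - d - h)) (nat (int b - d))"
        "1 \<le> nat (int a + int b - d - h)" "1 \<le> nat (int b - d)"
        "nat (int a + int b - d - h) + nat (int b - d) \<le> a"
        by (auto simp: e_cell_def)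
      then show ?l by blast
    qed (auto simp: e_cell_def)
    have dnE: "Down d h \<in> ?E \<longleftrightarrow> d < int b \<and> d + h < int a + int b \<and> 2 * int b \<le> 2 * d + h" (is "?l \<longleftrightarrow> ?r")
    proof
      assume ?r
      then have "Down d h \<in> e_cell a b (nat (int a + int b - d - h)) (nat (int b - d))"
        "1 \<le> nat (int a + int b - d - h)" "1 \<le> nat (int b - d)"
        "nat (int a + int b - d - h) + nat (int b - d) \<le> a"
        by (auto simp: e_cell_def)
      then show ?l by blast
    qed (auto simp: e_cell_def)
    have sink: "(d, h) \<in> sink a b c ` {..<b} \<longleftrightarrow>
        int b - int c - 1 \<ge> d \<and> - int c \<le> d \<and> h = d + int a + 2 * int c - int b + 1" (is "?l \<longleftrightarrow> ?r")
    proof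
      assume ?r
      then have "(d, h) = sink a b c (nat (int b - int c - 1 - d))" "nat (int b - int c - 1 - d) < b"
        by (auto simp: sink_def)
      then show ?l by blast
    qed (auto simp: sink_def)
    show "Up d h \<in> ?H - (?N \<union> ?E) \<longleftrightarrow> Up d h \<in> triangles_of (edges a b c) (sink a b c ` {..<b})"
      unfolding Diff_iff Un_iff upN upE triangles_of_simps sink using assms by (auto simp: edges_def)
    show "Down d h \<in> ?H - (?N \<union> ?E) \<longleftrightarrow> Down d h \<in> triangles_of (edges a b c) (sink a b c ` {..<b})"
      unfolding Diff_iff Un_iff dnN dnE triangles_of_simps using assms by (auto simp: edges_def)
  qed
  finally show ?thesis .
qed

section \<open>Lattice paths beside a vertical wall\<close>

definition ichoose :: "int \<Rightarrow> int \<Rightarrow> real" where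
  "ichoose n k = ifact n * rfact k * rfact (n - k)"

lemma ichoose_symmetric: "ichoose n (n - k) = ichoose n k"
  by (simp add: ichoose_def)

lemma ichoose_zero: "k < 0 \<or> n < k \<Longrightarrow> ichoose n k = 0"
  by (auto simp: ichoose_def rfact_def)

lemma ichoose_self: "0 \<le> n \<Longrightarrow> ichoose n n = 1"
  by (simp add: ichoose_def ifact_def rfact_def)

lemma ichoose_Pascal:
  assumes "1 \<le> n"
  shows "ichoose n k = ichoose (n - 1) k + ichoose (n - 1) (k - 1)"
proof -
  have 1: "rfact (n - 1 - k) = of_int (n - k) * rfact (n - k)"
    using rfact_rec[of "n - k"] by (simp add: algebra_simps)
  have 2: "rfact (k - 1) = of_int k * rfact k" by (rule rfact_rec)
  have 3: "n - 1 - (k - 1) = n - k" by simp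
  show ?thesis
    unfolding ichoose_def ifact_rec[OF assms] 1 2 3 by (simp add: algebra_simps)
qed

text \<open>Both binomial coefficients are multiples of \<open>n! / (A! B!)\<close>, with the quadratic factors
\<open>B * (B - 1)\<close> and \<open>A * (A - 1)\<close>; their difference is \<open>(B - A) * (n + 1)\<close>.\<close>

lemma ichoose_diff:
  assumes "0 \<le> n" "A + B = n + 2"
  shows "ichoose n (B - 2) - ichoose n B = of_int (B - A) * (ifact (n + 1) * rfact A * rfact B)"
proof -
  have 1: "rfact (B - 2) = of_int (B - 1) * of_int B * rfact B"
    using rfact_rec[of "B - 1"] rfact_rec[of B] by simp
  have 2: "rfact (A - 2) = of_int (A - 1) * of_int A * rfact A"
    using rfact_rec[of "A - 1"] rfact_rec[of A] by simp
  have n: "n - B = A - 2" "n - (B - 2) = A" using assms by auto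
  have 3: "ifact (n + 1) = of_int (n + 1) * ifact n" using ifact_rec[of "n + 1"] assms by simp
  have "n + 1 = A + B - 1" using assms(2) by linarith
  then have key: "real_of_int (B - 1) * of_int B - of_int (A - 1) * of_int A = of_int (B - A) * of_int (n + 1)"
    by (simp only:) (simp add: algebra_simps)
  have "ichoose n (B - 2) - ichoose n B =
      ifact n * rfact A * rfact B * (of_int (B - 1) * of_int B - of_int (A - 1) * of_int A)"
    unfolding ichoose_def n 1 2 by (simp only: right_diff_distrib mult_ac)
  then show ?thesis unfolding key 3 by (simp only: mult_ac)
qed

text \<open>By reflection at the wall \<open>2 * d + h = 2 * b\<close>, this is the number of paths from the edge
\<open>(b - 1 + m, - 2 * m)\<close> to an edge \<open>(d, h)\<close> left of the wall that do not touch it.  At height zero, such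
paths end in one of the \<open>m + 1\<close> rightmost starting edges, and only one path ends in the leftmost
of these.  So the matrix of these numbers at the starting edges is unitriangular.  The starting
edges themselves would give the same determinants, but their entries at the end points do not reduce
to single terms in general.\<close>

definition wall_paths :: "nat \<Rightarrow> nat \<Rightarrow> int \<Rightarrow> int \<Rightarrow> real" where
  "wall_paths b m d h = ichoose (h + 2 * int m) (int b - d + int m - 1)
                      - ichoose (h + 2 * int m) (int b - d + int m + 1)"

lemma wall_paths_rec:
  assumes "0 < h"
  shows "wall_paths b m d h = wall_paths b m d (h - 1) + wall_paths b m (d + 1) (h - 1)"
  using assms ichoose_Pascal[of "h + 2 * int m" "int b - d + int m - 1"]
    ichoose_Pascal[of "h + 2 * int m" "int b - d + int m + 1"]
  by (simp add: wall_paths_def algebra_simps)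

lemma wall_paths_wall:
  assumes "2 * d + h = 2 * int b"
  shows "wall_paths b m d h = 0"
proof -
  have "h + 2 * int m - (int b - d + int m - 1) = int b - d + int m + 1" using assms by simp
  from ichoose_symmetric[of "h + 2 * int m" "int b - d + int m - 1", unfolded this]
  show ?thesis by (simp add: wall_paths_def)
qed

lemma wall_paths_left:
  assumes "d + h < 0" "m < b"
  shows "wall_paths b m d h = 0"
proof -
  have "h + 2 * int m < int b - d + int m - 1" "h + 2 * int m < int b - d + int m + 1"
    using assms by linarith+
  then show ?thesis by (simp add: wall_paths_def ichoose_zero)
qed

lemma wall_paths_start: "detf b (\<lambda>i m. wall_paths b m (int b - 1 - int i) 0) = 1"
proof -
  have "detf b (\<lambda>i m. wall_paths b m (int b - 1 - int i) 0) = (\<Prod>i<b. wall_paths b i (int b - 1 - int i) 0)"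
    by (rule detf_triangular') (auto simp: wall_paths_def ichoose_zero)
  also have "\<dots> = (\<Prod>i<b. 1)"
    by (rule prod.cong) (auto simp: wall_paths_def ichoose_zero ichoose_self algebra_simps)
  finally show ?thesis by simp
qed

text \<open>At the end points, the two binomial coefficients have lower indices that differ by two and
an upper index with \<open>A + B = n + 2\<close>, so their difference is a single term.\<close>

lemma wall_paths_sink:
  assumes "b \<le> a" "i < b"
  shows "wall_paths b m (fst (sink a b c i)) (snd (sink a b c i)) =
     of_int (int c + 2 - int a + 3 * int i) * reduced_entry (int a) (int c + 2) i m"
proof -
  let ?n = "int a + int c - int i + 2 * int m"
  have "wall_paths b m (fst (sink a b c i)) (snd (sink a b c i)) =
      ichoose ?n (int c + 2 + int i + int m - 2) - ichoose ?n (int c + 2 + int i + int m)"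
    by (simp add: wall_paths_def sink_def algebra_simps)
  also have "\<dots> = of_int (int c + 2 + int i + int m - (int a - 2 * int i + int m)) *
      (ifact (?n + 1) * rfact (int a - 2 * int i + int m) * rfact (int c + 2 + int i + int m))"
    using assms by (intro ichoose_diff) auto
  finally show ?thesis by (simp add: reduced_entry_def algebra_simps)
qed

lemma finite_edges: "finite (edges a b c)"
proof (rule finite_subset)
  show "edges a b c \<subseteq> {- int c..int b} \<times> {0..int a + int b + int c}"
    by (auto simp: edges_def)
qed simp

lemma card_matchings_hexagon_d:
  assumes "0 < a" "0 < b" "0 < c" "b \<le> a" "a \<le> c"
  shows "real (card (matchings (triangles_of (edges a b c) (sink a b c ` {..<b})))) =
    (\<Prod>i<b. of_int (int c + 2 - int a + 3 * int i)) * reduced_product b (int a) (int c + 2)"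
proof -
  have "real (card (matchings (triangles_of (edges a b c) (sink a b c ` {..<b})))) =
    detf b (\<lambda>i k. wall_paths b k (fst (sink a b c i)) (snd (sink a b c i)))"
  proof (rule card_matchings_eq_det)
    show "finite (edges a b c)" by (rule finite_edges)
    show "0 \<le> h" if "(d, h) \<in> edges a b c" for d h using that by (simp add: edges_def)
    show "(d, 0) \<in> edges a b c \<longleftrightarrow> 0 \<le> d \<and> d < int b" for d
      using assms by (auto simp: edges_def)
    show "wall_paths b k d h = wall_paths b k d (h - 1) + wall_paths b k (d + 1) (h - 1)" if "0 < h" for k d h
      using that by (rule wall_paths_rec)
    show "(d, h - 1) \<in> edges a b c \<or> wall_paths b k d (h - 1) = 0"
      if "k < b" "(d, h) \<in> edges a b c" "0 < h" for k d h
    proof (cases "d + h = 0")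
      case True
      then show ?thesis using that by (intro disjI2 wall_paths_left) auto
    qed (use that in \<open>auto simp: edges_def\<close>)
    show "(d + 1, h - 1) \<in> edges a b c \<or> wall_paths b k (d + 1) (h - 1) = 0"
      if "k < b" "(d, h) \<in> edges a b c" "0 < h" for k d h
    proof (cases "2 * d + h = 2 * int b - 1")
      case True
      then show ?thesis by (intro disjI2 wall_paths_wall) auto
    qed (use that in \<open>auto simp: edges_def\<close>)
    show "detf b (\<lambda>i k. wall_paths b k (int b - 1 - int i) 0) = 1" by (rule wall_paths_start)
    show "sink a b c i \<in> edges a b c" if "i < b" for i
      using that assms by (auto simp: sink_def edges_def)
    show "upper_right (sink a b c i) (sink a b c j)" if "i < j" "j < b" for i j
      using that by (auto simp: upper_right_def sink_def)
  qed
  also have "\<dots> = detf b (\<lambda>i k. of_int (int c + 2 - int a + 3 * int i) * reduced_entry (int a) (int c + 2) i k)"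
    using assms by (intro detf_cong wall_paths_sink) auto
  also have "\<dots> = (\<Prod>i<b. of_int (int c + 2 - int a + 3 * int i)) * detf b (reduced_entry (int a) (int c + 2))"
    by (rule detf_scale_rows)
  also have "detf b (reduced_entry (int a) (int c + 2)) = reduced_product b (int a) (int c + 2)"
    using assms by (intro det_reduced_entry) auto
  finally show ?thesis .
qed

section \<open>The product formula\<close>

lemma prod_Suc_atMost: "(\<Prod>j = 1..n::nat. f j) = (\<Prod>i<n. f (Suc i))"
  by (rule prod.reindex_bij_witness[of _ Suc "\<lambda>j. j - 1"]) auto

lemma prod_reverse_atMost: "(\<Prod>j = 1..n::nat. f j) = (\<Prod>i<n. f (n - i))"
  by (rule prod.reindex_bij_witness[of _ "\<lambda>i. n - i" "\<lambda>j. n - j"]) auto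

lemma sign_prod: "(- 1 :: real) ^ (n * (n + 1) div 2) = (\<Prod>j = 1..n. (- 1) ^ j)"
proof (induction n)
  case (Suc n)
  have "Suc n * (Suc n + 1) = n * (n + 1) + Suc n * 2" by simp
  then have half: "Suc n * (Suc n + 1) div 2 = n * (n + 1) div 2 + Suc n"
    by (simp only: div_mult_self1[of 2] zero_neq_numeral[symmetric] not_False_eq_True add.commute)
  have "(\<Prod>j = 1..Suc n. (- 1 :: real) ^ j) = (\<Prod>j = 1..n. (- 1) ^ j) * (- 1) ^ Suc n"
    by simp
  then show ?case unfolding half power_add Suc.IH ..
qed simp

text \<open>The factors of the product are matched kind by kind; those whose arguments decrease are
taken in reverse order.  The sign reflects the rising factorials with negative arguments, and the
row factors extend each of the resulting rising factorials by one term.\<close>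

lemma P_eq_reduced_product:
  fixes a b c :: nat
  assumes "b \<le> a"
  shows "(- 1) ^ (b * (b + 1) div 2) * P b (int a - 2 * int b - 1) (int b + int c + 1) =
    (\<Prod>i<b. of_int (int c + 2 - int a + 3 * int i)) * reduced_product b (int a) (int c + 2)"
proof -
  let ?x = "int a - 2 * int b - 1" and ?y = "int b + int c + 1"
  have F: "(\<Prod>j = 1..b. fact (j - 1) :: real) = (\<Prod>i<b. fact i)"
    unfolding prod_Suc_atMost by simp
  have N: "(\<Prod>j = 1..b. fact (nat (?x + ?y + 2 * int j)) :: real) = prod2 ifact b (int a + (int c + 2) - int b)"
    unfolding prod_Suc_atMost prod2_def ifact_def by (rule prod.cong) (auto simp: algebra_simps)
  have D: "(\<Prod>j = 1..b. 1 / fact (nat (?x + int b + 2 * int j)) :: real) = prod2 rfact b (int a + 1 - int b)"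
    unfolding prod_Suc_atMost prod2_def using assms
    by (intro prod.cong) (auto simp: rfact_def algebra_simps)
  have E: "(\<Prod>j = 1..b. 1 / fact (nat (?y + int b - int j)) :: real) = prod1 rfact b (int c + 2 + int b - 1)"
    unfolding prod_reverse_atMost prod1_def
    by (intro prod.cong) (auto simp: rfact_def of_nat_diff algebra_simps)
  have W: "(\<Prod>j = 1..b. pochhammer (of_int (?x + 2 * ?y + 3 * int j + 1)) (b - j) :: real)
      = poch3 b (int a + 2 * (int c + 2))"
    unfolding prod_Suc_atMost poch3_def by (rule prod.cong) (auto simp: algebra_simps)
  have S: "(- 1) ^ (b * (b + 1) div 2) * (\<Prod>j = 1..b. pochhammer (of_int (?x - ?y + 2 * int j + 1)) j :: real)
      = (\<Prod>i<b. of_int (int c + 2 - int a + 3 * int i)) * poch3 b (int c + 2 - int a)"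
  proof -
    have "(- 1) ^ j * pochhammer (of_int (?x - ?y + 2 * int j + 1)) j
        = (pochhammer (of_int (?y - ?x - 3 * int j)) j :: real)" for j
    proof -
      define z where "z = real_of_int (?x - ?y + 2 * int j + 1)"
      have "pochhammer z j = (- 1) ^ j * pochhammer (- z - real j + 1) j"
        using pochhammer_minus[of "- z" j] by simp
      moreover have "- z - real j + 1 = of_int (?y - ?x - 3 * int j)"
        by (simp add: z_def)
      moreover have "(- 1) ^ j * ((- 1) ^ j * r) = r" for r :: real
        by (simp flip: mult.assoc power_mult_distrib)
      ultimately show ?thesis by (simp only: z_def)
    qed
    then have "(- 1) ^ (b * (b + 1) div 2) * (\<Prod>j = 1..b. pochhammer (of_int (?x - ?y + 2 * int j + 1)) j :: real)
        = (\<Prod>j = 1..b. pochhammer (of_int (?y - ?x - 3 * int j)) j)"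
      by (simp only: sign_prod flip: prod.distrib)
    also have "\<dots> = (\<Prod>i<b. of_int (int c + 2 - int a + 3 * int i)
        * pochhammer (of_int (int c + 2 - int a + 1 + 3 * int i)) (b - 1 - i))"
      unfolding prod_reverse_atMost
    proof (rule prod.cong)
      fix i assume "i \<in> {..<b}"
      then have "?y - ?x - 3 * int (b - i) = int c + 2 - int a + 3 * int i" and "b - i = Suc (b - 1 - i)"
        by (auto simp: of_nat_diff)
      then show "pochhammer (of_int (?y - ?x - 3 * int (b - i))) (b - i) =
          of_int (int c + 2 - int a + 3 * int i)
          * (pochhammer (of_int (int c + 2 - int a + 1 + 3 * int i)) (b - 1 - i) :: real)"
        by (simp only: pochhammer_rec) (simp add: algebra_simps)
    qed simp
    finally show ?thesis by (simp only: prod.distrib poch3_def)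
  qed
  have Pb: "P b ?x ?y = (\<Prod>j = 1..b. fact (j - 1)) * (\<Prod>j = 1..b. fact (nat (?x + ?y + 2 * int j)))
    * (\<Prod>j = 1..b. pochhammer (of_int (?x - ?y + 2 * int j + 1)) j)
    * (\<Prod>j = 1..b. pochhammer (of_int (?x + 2 * ?y + 3 * int j + 1)) (b - j))
    * (\<Prod>j = 1..b. 1 / fact (nat (?x + int b + 2 * int j)))
    * (\<Prod>j = 1..b. 1 / fact (nat (?y + int b - int j)))"
    unfolding P_def prod.distrib[symmetric] by (rule prod.cong) simp_all
  have alg: "s * (f * n * z * w * d * e) = R * (f * n * p * w * d * e)" if "s * z = R * p"
    for s f n z w d e R p :: real
  proof -
    have "s * (f * n * z * w * d * e) = (s * z) * (f * n * w * d * e)" by (simp only: mult_ac)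
    also have "\<dots> = R * (f * n * p * w * d * e)" unfolding that by (simp only: mult_ac)
    finally show ?thesis .
  qed
  show ?thesis unfolding Pb F N W D E reduced_product_def by (rule alg[OF S])
qed

theorem theorem1p1:
  fixes a b c :: nat
  assumes "0 < a" and "0 < b" and "0 < c"
    and "b \<le> a" and "a \<le> c"
  shows "real (num_lozenge_tilings (hexagon_d a b c)) =
    (- 1) ^ (b * (b + 1) div 2) * P b (int a - 2 * int b - 1) (int b + int c + 1)"
  unfolding hexagon_d_eq[OF assms] num_lozenge_tilings_region card_matchings_hexagon_d[OF assms]
    P_eq_reduced_product[OF assms(4)] ..

end
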